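(* Let $\{f_t\}$ be the sequence generated by POLK with $f_0=0$, and let $f^*$ be the minimizer of the regularized expected risk $R$. Suppose Assumptions (A1)–(A4) hold, and the step-sizes and approximation budgets satisfy $$\sum_{t=1}^\infty \eta_t=\infty,\qquad \sum_{t=1}^\infty \eta_t^2<\infty,\qquad \epsilon_t=\eta_t^2,$$ with $\eta_t<1/\lambda$ for all $t$. Then $$\liminf_{t\to\infty} R(f_t)-R(f^* )=0\quad\text{almost surely},$$ and moreover $$\lim_{t\to\infty}\|f_t-f^*\|_{\mathcal H}^2=0\quad\text{almost surely}.$$
   Context: Setting: $\mathcal X\subset\mathbb R^p$, $\mathcal Y\subset\mathbb R$; $\mathcal H$ is a reproducing kernel Hilbert space of functions $f:\mathcal X\to\mathbb R$ with reproducing kernel $\kappa$ (so $\langle f,\kappa(x,\cdot)\rangle_{\mathcal H}=f(x)$). $(x,y)$ is a random pair on $\mathcal X\times\mathcal Y$ with a fixed joint distribution, and $(x_t,y_t)$, $t=0,1,2,\dots$ are i.i.d. copies of it. The loss is $\ell:\mathbb R\times\mathcal Y\to\mathbb R$, $\ell'(z,y)=\partial\ell(z,y)/\partial z$. With $\lambda>0$, the regularized expected risk is $R(f)=\mathbb E_{x,y}[\ell(f(x),y)]+\frac{\lambda}{2}\|f\|_{\mathcal H}^2$ and $f^*=\arg\min_{f\in\mathcal H}R(f)$. POLK (Parsimonious Online Learning with Kernels): given step-sizes $\eta_t>0$ and approximation budgets $\epsilon_t>0$, set $f_0=0$ with empty dictionary $D_0$. At step $t$, with $f_t=\sum_{n=1}^{M_t}w_n\kappa(d_n,\cdot)$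 parameterized by dictionary $D_t=[d_1,\dots,d_{M_t}]$, form $\tilde f_{t+1}=(1-\eta_t\lambda)f_t-\eta_t\ell'(f_t(x_t),y_t)\kappa(x_t,\cdot)$, represented by dictionary $\tilde D_{t+1}=[D_t,\,x_t]$. Then apply destructive kernel orthogonal matching pursuit (KOMP) with budget $\epsilon_t$: starting from $D=\tilde D_{t+1}$, repeatedly compute for each remaining element $d_j$ the error $\gamma_j=\min_{w}\|\tilde f_{t+1}-\sum_{k\neq j}w_k\kappa(d_k,\cdot)\|_{\mathcal H}$; if $\min_j\gamma_j>\epsilon_t$ stop, otherwise remove the minimizing element and continue (while the dictionary is nonempty). The output dictionary is $D_{t+1}$, and $f_{t+1}$ is the orthogonal projection of $\tilde f_{t+1}$ onto $\mathcal H_{D_{t+1}}=\mathrm{span}\{\kappa(d,\cdot):d\in D_{t+1}\}$; thus $\|f_{t+1}-\tilde f_{t+1}\|_{\mathcal H}\le\epsilon_t$. The model order $M_t$ is the number of elements of $D_t$. Define $\hat\nabla_t=\ell'(f_t(x_t),y_t)\kappa(x_t,\cdot)+\lambda f_t$ and the projected stochastic gradient $\tilde\nabla_t=(f_t-f_{t+1})/\eta_t$, so $f_{t+1}=f_t-\eta_t\tilde\nabla_t$. $\mathcal F_t$ denotes the sigma-algebra generated by the algorithm history up to time $t$. Assumptions: (A1) $\mathcal X$ and $\mathcal Y$ are compact and $\sup_{x\in\mathcal X}\sqrt{\kappa(x,x)}=X<\infty$. (A2) $\ell$ is $C$-Lipschitz in its first argument: $|\ell(z,y)-\ell(z',y)|\le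 C|z-z'|$ for all $z,z'\in\mathbb R$, $y\in\mathcal Y$. (A3) $\ell(z,y)$ is convex and differentiable in $z$ on $\mathbb R$ for all $y$. (A4) $\mathbb E[\|\tilde\nabla_t\|_{\mathcal H}^2\mid\mathcal F_t]\le\sigma^2$ for all $t$. *)

theory Defs
  imports "HOL-Analysis.Analysis" "HOL-Probability.Probability"
begin

text \<open>The RKHS is modelled as an abstract real Hilbert space 'h together with the
  feature map k, where k x stands for kappa(x, .). A function f in H is evaluated
  by f(x) = inner f (k x), and kappa(x,x') = inner (k x) (k x').\<close>

definition eval_rkhs :: "('x \<Rightarrow> 'h::real_inner) \<Rightarrow> 'h \<Rightarrow> 'x \<Rightarrow> real" where
  "eval_rkhs k f x = inner f (k x)"

definition kern :: "('x \<Rightarrow> 'h::real_inner) \<Rightarrow> 'x \<Rightarrow> 'x \<Rightarrow> real" where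
  "kern k x x' = inner (k x) (k x')"

definition del_nth :: "nat \<Rightarrow> 'a list \<Rightarrow> 'a list" where
  "del_nth j D = take j D @ drop (Suc j) D"

definition HD :: "('x \<Rightarrow> 'h::real_inner) \<Rightarrow> 'x list \<Rightarrow> 'h set" where
  "HD k D = span (k ` set D)"

definition orth_proj :: "'h::real_inner set \<Rightarrow> 'h \<Rightarrow> 'h" where
  "orth_proj S g = (SOME p. p \<in> S \<and> (\<forall>z\<in>S. inner (g - p) z = 0))"

text \<open>KOMP error of removing element j: min_w || g - sum_{i<>j} w_i kappa(d_i,.) ||.\<close>
definition komp_err :: "('x \<Rightarrow> 'h::real_inner) \<Rightarrow> 'h \<Rightarrow> 'x list \<Rightarrow> nat \<Rightarrow> real" where
  "komp_err k g D j = infdist g (HD k (del_nth j D))"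

definition komp_idx :: "('x \<Rightarrow> 'h::real_inner) \<Rightarrow> 'h \<Rightarrow> 'x list \<Rightarrow> nat" where
  "komp_idx k g D = (LEAST j. j < length D \<and> (\<forall>i<length D. komp_err k g D j \<le> komp_err k g D i))"

function komp :: "('x \<Rightarrow> 'h::real_inner) \<Rightarrow> real \<Rightarrow> 'h \<Rightarrow> 'x list \<Rightarrow> 'x list" where
  "komp k eps g D =
     (if D = [] then []
      else (let j = komp_idx k g D in
            if j < length D \<and> komp_err k g D j \<le> eps
            then komp k eps g (del_nth j D) else D))"
  by pat_completeness auto
termination
  by (relation "Wellfounded.measure (\<lambda>(k, eps, g, D). length D)")
     (auto simp: del_nth_def min_def)

fun polk :: "('x \<Rightarrow> 'h::real_inner) \<Rightarrow> (real \<Rightarrow> real \<Rightarrow> real) \<Rightarrow> real \<Rightarrow>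
             (nat \<Rightarrow> real) \<Rightarrow> (nat \<Rightarrow> real) \<Rightarrow> (nat \<Rightarrow> 'x) \<Rightarrow> (nat \<Rightarrow> real) \<Rightarrow> nat \<Rightarrow> 'h \<times> 'x list" where
  "polk k l lam eta eps xs ys 0 = (0, [])"
| "polk k l lam eta eps xs ys (Suc t) =
     (let f = fst (polk k l lam eta eps xs ys t);
          D = snd (polk k l lam eta eps xs ys t);
          ft = (1 - eta t * lam) *\<^sub>R f
               - (eta t * deriv (\<lambda>z. l z (ys t)) (eval_rkhs k f (xs t))) *\<^sub>R k (xs t);
          D' = komp k (eps t) ft (D @ [xs t])
      in (orth_proj (HD k D') ft, D'))"

definition risk :: "('x \<Rightarrow> 'h::real_inner) \<Rightarrow> (real \<Rightarrow> real \<Rightarrow> real) \<Rightarrow> real \<Rightarrow> ('x \<times> real) measure \<Rightarrow> 'h \<Rightarrow> real" where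
  "risk k l lam P f = (\<integral>z. l (eval_rkhs k f (fst z)) (snd z) \<partial>P) + lam / 2 * (norm f)^2"

text \<open>F_t: sigma-algebra generated by the history up to time t, i.e. by the samples
  (x_s, y_s), s < t (the iterates f_s, D_s, s \<le> t, are deterministic functions of these).\<close>
definition hist :: "'w measure \<Rightarrow> (nat \<Rightarrow> 'w \<Rightarrow> 'x::topological_space) \<Rightarrow> (nat \<Rightarrow> 'w \<Rightarrow> real) \<Rightarrow> nat \<Rightarrow> 'w measure" where
  "hist M xs ys t = sigma (space M)
     (\<Union>s\<in>{..<t}. {(\<lambda>w. (xs s w, ys s w)) -` A \<inter> space M | A. A \<in> sets (borel :: ('x \<times> real) measure)})"

end

theory Submission
  imports Defs
begin

text \<open>
The Lipschitz bound and the contraction factor 1 - eta lam keep all iterates in the ball of radius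
C Xb / lam, and KOMP perturbs a step by at most eta^2. Convexity of the loss together with the
minimality of fstar then gives, for V_t = norm (f_t - fstar)^2,

  V_(t+1) \<le> (1 - lam eta_t) V_t + 2 eta_t xi_t + K eta_t^2

with bounded martingale differences xi_t. The series of eta_t xi_t converges almost surely by a
Kolmogorov maximal inequality, so V_t converges, and since the eta_t are not summable its limit
is 0; the risk is Lipschitz on bounded sets, so it converges as well.

The Hilbert space is not assumed separable, and measurability of the iterates is not available
without separability: not even inner (k x) (k x') need be jointly measurable a priori. It is
recovered from the fact that a Borel map from a Polish space into a metric space has almost surely
separable range: otherwise Stone's sigma-discrete refinement of a cover by balls yields a Borel map
onto an uncountable discrete space with null fibres, hence a map U to [0,1] with uniform law
all of whose preimages are Borel, and Lusin's theorem applied to preimages of the pieces of a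
Vitali decomposition gives a compact subset of positive length in one of these pieces.
\<close>

section \<open>Borel maps have almost surely separable range\<close>

text \<open>Discreteness of the range alone gives no contradiction: an atomless measure defined on
  all subsets of [0,1] cannot be refuted in ZFC if measurable cardinals are consistent. What
  excludes it here is the Polish domain. Every preimage under the uniform map is a Borel subset of a
  Polish space, hence filled up to small mass by compact sets, and the map is continuous on suitable
  ones; their images are compact, hence Lebesgue measurable, which an arbitrary set of reals is not.

  In the descent the noise is a difference of losses, not of gradients: the tangent inequality is
  applied to the sampled loss before anything is averaged. The martingale differences are therefore
  real-valued and bounded, and no integral with values in \<open>'h\<close> is formed. The
  regularizer is expanded exactly and supplies the contraction, so minimality of
  \<open>fstar\<close> enters only as nonnegativity of the excess risk.\<close>

text \<open>\<open>V r\<close> has exactly one point in each coset of the rationals, so its nonzero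
  rational translates are disjoint from it. Arbitrarily many translates of a compact
  \<open>K\<close> fit into one bounded interval, which forces length 0. Only compact subsets are
  measured because the pieces themselves are not Lebesgue measurable.\<close>

lemma vitali_cover:
  obtains V :: "rat \<Rightarrow> real set"
  where "(\<Union>r. V r) = UNIV"
    and "\<And>r K. compact K \<Longrightarrow> K \<subseteq> V r \<Longrightarrow> emeasure lborel K = 0"
proof
  define rep :: "real \<Rightarrow> real" where "rep x = (SOME y. x - y \<in> \<rat>)" for x
  define V where "V r = {x. x - rep x = of_rat r}" for r
  have rep: "x - rep x \<in> \<rat>" for x
    unfolding rep_def by (rule someI[where x=x]) simp
  have rep_add: "rep (x + q) = rep x" if "q \<in> \<rat>" for x q
  proof -
    have "(\<lambda>y. x + q - y \<in> \<rat>) = (\<lambda>y. x - y \<in> \<rat>)"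
    proof
      fix y
      have "x + q - y = (x - y) + q" by simp
      then show "(x + q - y \<in> \<rat>) = (x - y \<in> \<rat>)"
        using that by (metis Rats_add Rats_diff add_diff_cancel_right')
    qed
    then show ?thesis by (simp add: rep_def)
  qed
  show "(\<Union>r. V r) = UNIV"
  proof -
    have "\<exists>r. x \<in> V r" for x
      using rep[of x] unfolding V_def by (auto elim!: Rats_cases)
    then show ?thesis by blast
  qed
  fix r K assume K: "compact K" "K \<subseteq> V r"
  have uniq: "q = 0" if "x \<in> V r" "x + q \<in> V r" "q \<in> \<rat>" for x q
    using that by (simp add: V_def rep_add)
  \<comment> \<open>Infinitely many distinct rationals in [0,1]: the translates stay in
    \<open>{-b..b+1}\<close> whatever their number.\<close>
  define c where "c i = (1 / real (Suc i))" for i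
  have cQ: "c i \<in> \<rat>" for i
    unfolding c_def by (intro Rats_divide) auto
  have c_inj: "c i = c j \<Longrightarrow> i = j" for i j by (simp add: c_def)
  obtain b where b: "\<And>x. x \<in> K \<Longrightarrow> \<bar>x\<bar> \<le> b" "b > 0"
    using compact_imp_bounded[OF K(1)] unfolding bounded_pos by auto
  have disj: "disjoint_family_on (\<lambda>i. (+) (c i) ` K) {..<n}" for n
  proof (clarsimp simp: disjoint_family_on_def, safe)
    fix i j x y
    assume "i \<noteq> j" and xy: "x \<in> K" "y \<in> K" "c i + x = c j + y"
    then have "x = y + (c j - c i)" by simp
    then have "c j - c i = 0"
      using uniq[of y "c j - c i"] xy(1,2) K(2) Rats_diff[OF cQ cQ] by (metis subsetD)
    with c_inj[of i j] \<open>i \<noteq> j\<close> show "c i + x \<in> {}" by simp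
  qed
  have lm: "(+) (c i) ` K \<in> lmeasurable" for i
    using K(1) by (intro lmeasurable_compact compact_translation) auto
  have "real n * measure lebesgue K \<le> 2 * b + 1" for n
  proof -
    have "real n * measure lebesgue K = (\<Sum>i<n. measure lebesgue ((+) (c i) ` K))"
      by (simp add: measure_translation)
    also have "\<dots> = measure lebesgue (\<Union>i<n. (+) (c i) ` K)"
      by (rule measure_finite_Union[symmetric])
        (use lm disj in \<open>auto simp: fmeasurable_def less_top simp del: emeasure_completion\<close>)
    also have "\<dots> \<le> measure lebesgue {-b..b+1}"
    proof (rule measure_mono_fmeasurable)
      show "(\<Union>i<n. (+) (c i) ` K) \<subseteq> {-b..b+1}"
      proof clarsimp
        fix i x assume "x \<in> K"
        moreover have "0 \<le> c i" "c i \<le> 1" by (auto simp: c_def divide_simps)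
        ultimately show "- b \<le> c i + x \<and> c i + x \<le> b + 1"
          using b(1)[of x] by (auto simp: abs_le_iff)
      qed
      show "{-b..b+1} \<in> lmeasurable" by simp
    qed (use lm in \<open>auto simp: fmeasurable_def\<close>)
    also have "\<dots> = 2 * b + 1" using b by simp
    finally show ?thesis .
  qed
  then have "measure lebesgue K \<le> 0"
    by (metis linorder_not_less ex_less_of_nat_mult)
  then have "measure lborel K = 0"
    using K(1) by (simp add: measure_le_0_iff compact_imp_closed borel_closed)
  then show "emeasure lborel K = 0"
    using K(1) by (metis emeasure_eq_ennreal_measure ennreal_0 emeasure_compact_finite less_top_ennreal top.not_eq_extremum infinity_ennreal_def)
qed

section \<open>Lusin's theorem on Polish spaces\<close>

lemma inner_regular_approx:
  fixes N :: "'a::polish_space measure"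
  assumes "finite_measure N" "sets N = sets borel" "B \<in> sets borel" "e > 0"
  obtains K where "compact K" "K \<subseteq> B" "measure N B - e < measure N K"
proof (cases "measure N B - e < 0")
  case True
  then show ?thesis using that[of "{}"] by simp
next
  case False
  interpret finite_measure N by fact
  have "ennreal (measure N B - e) < emeasure N B"
    using False \<open>e > 0\<close> by (simp add: emeasure_eq_measure ennreal_less_iff)
  also have "emeasure N B = (SUP K \<in> {K. K \<subseteq> B \<and> compact K}. emeasure N K)"
    using assms by (intro inner_regular) auto
  finally obtain K where "K \<subseteq> B" "compact K" "ennreal (measure N B - e) < emeasure N K"
    by (auto simp: less_SUP_iff)
  then show ?thesis
    using that[of K] False by (auto simp: emeasure_eq_measure ennreal_less_iff)
qed

text \<open>On \<open>L\<close> the preimage of each basic open set coincides with the compact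
  \<open>K n\<close> and its complement with the compact \<open>K' n\<close>, so both are relatively
  clopen. Countably many basic sets suffice for continuity, so the lost mass can be summed.\<close>

lemma lusin_compact:
  fixes N :: "'a::polish_space measure" and U :: "'a \<Rightarrow> 'b::second_countable_topology"
  assumes fin: "finite_measure N" and sN: "sets N = sets borel" and B: "B \<in> sets borel"
    and U: "U \<in> borel_measurable borel" and pos: "measure N B > 0"
  obtains L where "compact L" "L \<subseteq> B" "measure N L > 0" "continuous_on L U"
proof -
  interpret finite_measure N by fact
  obtain \<B> :: "'b set set" where Bas: "countable \<B>" "topological_basis \<B>"
    using ex_countable_basis by blast
  then have ne: "\<B> \<noteq> {}"
    unfolding topological_basis_def by (metis Union_empty UNIV_not_empty open_UNIV subset_empty)
  define T where "T n = from_nat_into \<B> n" for n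
  have T_open: "open (T n)" for n
    unfolding T_def using from_nat_into[OF ne] Bas(2) topological_basis_open by blast
  have T_basis: "\<exists>n. x \<in> T n \<and> T n \<subseteq> O'" if "open O'" "x \<in> O'" for x O'
    using topological_basisE[OF Bas(2) that] from_nat_into_surj[OF Bas(1)] unfolding T_def by metis
  define m where "m = measure N B"
  have UT: "B \<inter> U -` T n \<in> sets borel" "B - U -` T n \<in> sets borel" for n
    using B measurable_sets[OF U borel_open[OF T_open]] by auto
  \<comment> \<open>The two compact sets of stage \<open>n\<close> together miss at most
    \<open>m / 2 ^ (n + 2)\<close> of \<open>B\<close>; these losses add up to \<open>m / 2\<close>,
    so \<open>L\<close> keeps at least half of the mass.\<close>
  have e: "m / 2 ^ (n + 3) > 0" for n using pos by (simp add: m_def)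
  have "\<exists>K. compact K \<and> K \<subseteq> B \<inter> U -` T n \<and> measure N (B \<inter> U -` T n) - m / 2 ^ (n + 3) < measure N K" for n
    using inner_regular_approx[OF fin sN UT(1) e] by metis
  then obtain K where K: "\<And>n. compact (K n)" "\<And>n. K n \<subseteq> B \<inter> U -` T n"
      "\<And>n. measure N (B \<inter> U -` T n) - m / 2 ^ (n + 3) < measure N (K n)"
    by metis
  have "\<exists>K. compact K \<and> K \<subseteq> B - U -` T n \<and> measure N (B - U -` T n) - m / 2 ^ (n + 3) < measure N K" for n
    using inner_regular_approx[OF fin sN UT(2) e] by metis
  then obtain K' where K': "\<And>n. compact (K' n)" "\<And>n. K' n \<subseteq> B - U -` T n"
      "\<And>n. measure N (B - U -` T n) - m / 2 ^ (n + 3) < measure N (K' n)"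
    by metis
  define L where "L = (\<Inter>n. K n \<union> K' n)"
  have Kb[simp]: "K n \<in> sets N" "K' n \<in> sets N" "B \<in> sets N" for n
    using K(1) K'(1) B by (auto simp: sN compact_imp_closed)
  have cL: "compact L"
  proof -
    have "closed L"
      unfolding L_def using K(1) K'(1) by (intro closed_INT ballI compact_imp_closed compact_Un)
    moreover have "L = (K 0 \<union> K' 0) \<inter> L" unfolding L_def by auto
    ultimately show ?thesis using K(1) K'(1) by (metis compact_Int_closed compact_Un)
  qed
  have LB: "L \<subseteq> B" unfolding L_def using K(2) K'(2) by blast
  have small: "measure N (B - (K n \<union> K' n)) \<le> m / 2 * (1/2) ^ Suc n" for n
  proof -
    have "measure N (B - (K n \<union> K' n)) = measure N B - measure N (K n \<union> K' n)"
      using K(2)[of n] K'(2)[of n] by (intro finite_measure_Diff) auto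
    also have "measure N (K n \<union> K' n) = measure N (K n) + measure N (K' n)"
      using K(2)[of n] K'(2)[of n] by (intro finite_measure_Union) auto
    also have "measure N B = measure N (B \<inter> U -` T n) + measure N (B - U -` T n)"
      using UT sN by (subst finite_measure_Union[symmetric]) (auto intro: arg_cong[where f="measure N"])
    finally have "measure N (B - (K n \<union> K' n)) \<le> 2 * (m / 2 ^ (n + 3))"
      using K(3)[of n] K'(3)[of n] by linarith
    also have "\<dots> = m / 2 * (1/2) ^ Suc n"
      by (simp add: power_add power_divide)
    finally show ?thesis .
  qed
  have sm: "(\<lambda>n. m / 2 * (1/2) ^ Suc n) sums (m / 2 * 1)"
    by (intro sums_mult power_half_series)
  have summ: "summable (\<lambda>n. measure N (B - (K n \<union> K' n)))"
    by (rule summable_comparison_test'[OF sums_summable[OF sm], of 0]) (use small in auto)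
  have "measure N (\<Union>n. B - (K n \<union> K' n)) \<le> (\<Sum>n. measure N (B - (K n \<union> K' n)))"
    using summ by (intro finite_measure_subadditive_countably) (auto intro!: sets.Diff sets.Un)
  also have "\<dots> \<le> (\<Sum>n. m / 2 * (1/2) ^ Suc n)"
    using small summ sums_summable[OF sm] by (intro suminf_le) auto
  also have "\<dots> = m / 2" using sums_unique[OF sm] by simp
  also have "(\<Union>n. B - (K n \<union> K' n)) = B - L" unfolding L_def by auto
  finally have "measure N (B - L) \<le> m / 2" .
  moreover have "measure N (B - L) = m - measure N L"
    unfolding m_def using LB cL B by (intro finite_measure_Diff) (auto simp: sN compact_imp_closed)
  ultimately have "measure N L > 0" using pos by (simp add: m_def)
  moreover have "continuous_on L U"
    unfolding continuous_on_topological
  proof (intro ballI allI impI)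
    fix x O' assume x: "x \<in> L" and O': "open O'" "U x \<in> O'"
    obtain n where n: "U x \<in> T n" "T n \<subseteq> O'" using T_basis[OF O'] by blast
    have "x \<notin> K' n" using n K'(2) by blast
    moreover have "U y \<in> O'" if "y \<in> L" "y \<notin> K' n" for y
      using that K(2)[of n] n(2) unfolding L_def by blast
    ultimately show "\<exists>A. open A \<and> x \<in> A \<and> (\<forall>y\<in>L. y \<in> A \<longrightarrow> U y \<in> O')"
      using K'(1)[of n] by (intro exI[of _ "- K' n"]) (auto simp: compact_imp_closed open_Compl)
  qed
  ultimately show ?thesis using that cL LB by blast
qed

text \<open>Without atoms the cdf is continuous, so each level strictly between 0 and 1 is attained,
  and its sublevel set is a half-line whose endpoint has exactly that level.\<close>

lemma (in real_distribution) distr_cdf_uniform: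
  assumes atomless: "\<And>x. measure M {x} = 0"
  shows "distr M borel (cdf M) = uniform_measure lborel {0..1}"
proof (rule cdf_unique)
  have cont: "continuous_on UNIV (cdf M)"
    using atomless isCont_cdf by (simp add: continuous_on_eq_continuous_at)
  have G[measurable]: "cdf M \<in> borel_measurable borel"
    by (rule borel_measurable_continuous_onI[OF cont])
  show 1: "real_distribution (distr M borel (cdf M))"
    by (rule real_distribution_distr) simp
  show 2: "real_distribution (uniform_measure lborel {0..1})"
    unfolding real_distribution_def real_distribution_axioms_def
    by (auto intro: prob_space_uniform_measure)
  interpret D: real_distribution "distr M borel (cdf M)" by fact
  interpret E: real_distribution "uniform_measure lborel {0..1::real}" by fact
  have cD: "cdf (distr M borel (cdf M)) s = measure M {x. cdf M x \<le> s}" for s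
    by (subst cdf_def, subst measure_distr) (auto simp: vimage_def)
  have cE: "cdf (uniform_measure lborel {0..1}) s = max 0 (min s 1)" for s
  proof -
    have "{0..1} \<inter> {..s} = {0..min s 1}" by auto
    then show ?thesis by (simp add: cdf_def max_def min_def)
  qed
  have mid: "measure M {x. cdf M x \<le> s} = s" if s: "0 < s" "s < 1" for s
  proof -
    define T where "T = Sup {x. cdf M x \<le> s}"
    obtain a where a: "cdf M a < s"
      using eventually_happens[OF order_tendstoD(2)[OF cdf_lim_at_bot s(1)]] by auto
    obtain b where b: "cdf M b > s"
      using eventually_happens[OF order_tendstoD(1)[OF cdf_lim_at_top_prob s(2)]] by auto
    have "a \<le> b" using a b cdf_nondecreasing[of b a] by linarith
    then obtain c where c: "cdf M c = s"
      using IVT'[of "cdf M" a s b] a b cont continuous_on_subset by (metis less_imp_le subset_UNIV)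
    have bdd: "bdd_above {x. cdf M x \<le> s}"
    proof (rule bdd_aboveI[of _ b])
      fix x assume "x \<in> {x. cdf M x \<le> s}"
      then show "x \<le> b" using b cdf_nondecreasing[of b x] by (cases "x \<le> b") auto
    qed
    have "closed {x. cdf M x \<le> s}"
      by (intro closed_Collect_le cont continuous_on_const)
    then have T: "cdf M T \<le> s"
      using closed_contains_Sup[OF _ bdd] c unfolding T_def by auto
    have "c \<le> T" unfolding T_def using bdd c by (intro cSup_upper) auto
    then have "cdf M T = s" using T c cdf_nondecreasing[of c T] by simp
    moreover have "{x. cdf M x \<le> s} = {..T}"
    proof (intro set_eqI iffI)
      fix x assume "x \<in> {x. cdf M x \<le> s}" then show "x \<in> {..T}"
        unfolding T_def using bdd by (auto intro: cSup_upper)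
    next
      fix x assume "x \<in> {..T}" then show "x \<in> {x. cdf M x \<le> s}"
        using T cdf_nondecreasing[of x T] by auto
    qed
    ultimately show ?thesis by (simp add: cdf_def)
  qed
  show "cdf (distr M borel (cdf M)) = cdf (uniform_measure lborel {0..1})"
  proof
    fix s :: real
    consider "s < 0" | "s = 0" | "0 < s" "s < 1" | "s \<ge> 1" by linarith
    then show "cdf (distr M borel (cdf M)) s = cdf (uniform_measure lborel {0..1}) s"
    proof cases
      case 1
      then have "{x. cdf M x \<le> s} = {}" using cdf_nonneg by (auto simp: not_le intro: less_le_trans)
      then show ?thesis using 1 by (simp add: cD cE)
    next
      case 2
      \<comment> \<open>Level 0 need not be attained by the cdf, so it is squeezed below small
        positive levels.\<close>
      have "measure M {x. cdf M x \<le> 0} \<le> e" if "e > 0" for e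
      proof -
        have "measure M {x. cdf M x \<le> 0} \<le> measure M {x. cdf M x \<le> min e (1/2)}"
          using that by (intro finite_measure_mono) auto
        also have "\<dots> \<le> e" using mid[of "min e (1/2)"] that by auto
        finally show ?thesis .
      qed
      then have "measure M {x. cdf M x \<le> 0} \<le> 0" by (meson field_le_epsilon add_0 order_refl field_lbound_gt_zero dense_ge)
      then show ?thesis using 2 by (simp add: cD cE measure_le_0_iff)
    next
      case 3 then show ?thesis by (simp add: cD cE mid)
    next
      case 4
      then have "{x. cdf M x \<le> s} = UNIV" using cdf_bounded_prob order_trans by blast
      then show ?thesis using 4 prob_space by (simp add: cD cE)
    qed
  qed
qed

text \<open>Composing \<open>h\<close> with the cdf of its law keeps all preimages Borel and moves
  the law to Lebesgue measure, which is what \<open>vitali_cover\<close> speaks about.\<close>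

lemma borel_partition_not_atomless:
  fixes N :: "'a::polish_space measure" and h :: "'a \<Rightarrow> real"
  assumes N: "prob_space N" and sN: "sets N = sets borel"
    and h: "\<And>A. h -` A \<in> sets borel"
    and null: "\<And>r. measure N (h -` {r}) = 0"
  shows False
proof -
  interpret prob_space N by fact
  have spN: "space N = UNIV" using sets_eq_imp_space_eq[OF sN] by simp
  have hm[measurable]: "h \<in> borel_measurable N"
    by (rule measurableI) (auto simp: spN sN h)
  define Q where "Q = distr N borel h"
  interpret Q: real_distribution Q
    unfolding Q_def by (rule real_distribution_distr) simp
  have "measure Q {r} = 0" for r
    unfolding Q_def by (subst measure_distr) (auto simp: spN null)
  note unif = Q.distr_cdf_uniform[OF this]
  have cm[measurable]: "cdf Q \<in> borel_measurable borel"
    by (rule borel_measurable_mono) (auto simp: mono_def Q.cdf_nondecreasing)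
  define U where "U = cdf Q \<circ> h"
  have Um: "U \<in> borel_measurable N" unfolding U_def by (intro measurable_comp[OF hm cm])
  have Um': "U \<in> borel_measurable borel" using Um sN measurable_cong_sets by blast
  have Uall: "U -` A \<in> sets borel" for A
    unfolding U_def vimage_comp[symmetric] by (rule h)
  have "distr N borel U = uniform_measure lborel {0..1}"
    unfolding unif[symmetric] U_def using cm hm unfolding Q_def by (rule distr_distr[symmetric])
  then have U_null: "measure N (U -` K) = 0" if "K \<in> sets borel" "emeasure lborel K = 0" for K
  proof -
    have "measure N (U -` K) = measure (distr N borel U) K"
      using that Um by (subst measure_distr) (auto simp: spN)
    also have "\<dots> = measure lborel ({0..1} \<inter> K)"
      unfolding \<open>distr N borel U = _\<close> using that by (subst measure_uniform_measure) auto
    also have "\<dots> = 0"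
      using that by (metis (no_types, lifting) Int_lower2 emeasure_eq_0 measure_def enn2real_0 sets_lborel)
    finally show ?thesis .
  qed
  obtain V :: "rat \<Rightarrow> real set" where V: "(\<Union>r. V r) = UNIV"
      "\<And>r K. compact K \<Longrightarrow> K \<subseteq> V r \<Longrightarrow> emeasure lborel K = 0"
    using vitali_cover by blast
  \<comment> \<open>\<open>V r\<close> is not measurable, but its preimage is Borel by
    \<open>Uall\<close>, so countable additivity applies to the preimages and Lusin's theorem to one
    of positive mass.\<close>
  have "\<exists>r. measure N (U -` V r) > 0"
  proof (rule ccontr)
    assume "\<not> ?thesis"
    then have "U -` V r \<in> null_sets N" for r
      by (auto simp: null_sets_def emeasure_eq_measure measure_le_0_iff not_less sN Uall)
    then have "(\<Union>r. U -` V r) \<in> null_sets N" by (intro null_sets_UN)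
    then have "emeasure N (\<Union>r. U -` V r) = 0" by auto
    moreover have "(\<Union>r. U -` V r) = space N" using V(1) unfolding vimage_UN[symmetric] spN by simp
    ultimately show False using emeasure_space_1 by simp
  qed
  then obtain r where r: "measure N (U -` V r) > 0" by blast
  obtain L where L: "compact L" "L \<subseteq> U -` V r" "measure N L > 0" "continuous_on L U"
    using lusin_compact[OF finite_measure_axioms sN Uall Um' r] by blast
  have cU: "compact (U ` L)" using L compact_continuous_image by blast
  moreover have "U ` L \<subseteq> V r" using L(2) by auto
  ultimately have "measure N (U -` (U ` L)) = 0"
    by (intro U_null V(2)) (auto simp: compact_imp_closed)
  moreover have "measure N L \<le> measure N (U -` (U ` L))"
    using Uall L(1) by (intro finite_measure_mono) (auto simp: sN compact_imp_closed)
  ultimately show False using L(3) by simp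
qed

text \<open>A point is determined by the basic open sets that contain it, and a set of naturals can
  be coded by a real. This supplies real labels for the classes of a partition.\<close>

lemma ex_inj_polish_real: "\<exists>j :: 'a::polish_space \<Rightarrow> real. inj j"
proof -
  obtain \<B> :: "'a set set" where Bas: "countable \<B>" "topological_basis \<B>"
    using ex_countable_basis by blast
  define g :: "'a \<Rightarrow> nat set" where "g x = to_nat_on \<B> ` {B\<in>\<B>. x \<in> B}" for x
  have "inj g"
  proof (rule injI, rule ccontr)
    fix x y assume eq: "g x = g y" and "x \<noteq> y"
    then obtain S where "open S" "x \<in> S" "y \<notin> S" using t1_space by blast
    then obtain B where B: "B \<in> \<B>" "x \<in> B" "y \<notin> B"
      using topological_basisE[OF Bas(2)] by (metis subsetD)
    then have "to_nat_on \<B> B \<in> g y" using eq[symmetric] by (auto simp: g_def)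
    then obtain B' where "B' \<in> \<B>" "y \<in> B'" "to_nat_on \<B> B = to_nat_on \<B> B'"
      by (auto simp: g_def)
    then show False using B Bas(1) by (metis inj_on_eq_iff inj_on_to_nat_on)
  qed
  moreover obtain j :: "nat set \<Rightarrow> real" where "inj j"
    using nat_sets_lepoll_reals01 unfolding lepoll_def by blast
  ultimately show ?thesis using inj_compose by blast
qed

text \<open>The law of \<open>q\<close> has at most countably many atoms. Mass outside of them, once
  normalised, would be carried by null classes, contrary to
  \<open>borel_partition_not_atomless\<close>.\<close>

lemma borel_partition_AE_countable:
  fixes N :: "'a::polish_space measure" and q :: "'a \<Rightarrow> 'i"
  assumes N: "finite_measure N" and sN: "sets N = sets borel"
    and q: "\<And>A. q -` A \<in> sets borel"
  obtains I where "countable I" "AE x in N. q x \<in> I"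
proof -
  interpret finite_measure N by fact
  have spN: "space N = UNIV" using sets_eq_imp_space_eq[OF sN] by simp
  have qm: "q \<in> measurable N (count_space UNIV)"
    by (rule measurableI) (auto simp: spN sN q)
  define D where "D = distr N (count_space UNIV) q"
  interpret D: finite_measure D unfolding D_def by (rule finite_measure_distr[OF qm])
  define I where "I = {i. measure D {i} \<noteq> 0}"
  have mD: "measure D {i} = measure N (q -` {i})" for i
    unfolding D_def using qm by (subst measure_distr) (auto simp: spN)
  define B where "B = q -` (- I)"
  have B: "B \<in> sets N" unfolding B_def sN by (rule q)
  have "measure N B = 0"
  proof (rule ccontr)
    assume "measure N B \<noteq> 0"
    then have pos: "emeasure N B \<noteq> 0" by (simp add: emeasure_eq_measure)
    define N' where "N' = uniform_measure N B"
    have N': "prob_space N'"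
      unfolding N'_def using pos by (intro prob_space_uniform_measure) auto
    obtain j :: "'a \<Rightarrow> real" where j: "inj j" using ex_inj_polish_real by blast
    \<comment> \<open>The type \<open>'i\<close> may be too large to embed into the reals, but there
      are no more classes than points: each class is labelled by the code of a chosen
      member.\<close>
    define h where "h x = j (SOME z. q z = q x)" for x
    have h_eq: "q x = q y" if "h x = h y" for x y
    proof -
      have "q (SOME z. q z = q x) = q x" "q (SOME z. q z = q y) = q y"
        by (rule someI[where x=x], simp) (rule someI[where x=y], simp)
      moreover have "(SOME z. q z = q x) = (SOME z. q z = q y)"
        using that j unfolding h_def by (simp add: inj_eq)
      ultimately show ?thesis by metis
    qed
    have hA: "h -` A \<in> sets borel" for A
    proof -
      have "h -` A = q -` ((\<lambda>i. j (SOME z. q z = i)) -` A)" by (auto simp: h_def)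
      then show ?thesis using q by simp
    qed
    have "measure N' (h -` {r}) = 0" for r
    proof (cases "h -` {r} \<inter> B = {}")
      case True
      then show ?thesis unfolding N'_def
        using pos hA sN by (subst measure_uniform_measure) (auto simp: Int_commute emeasure_eq_measure)
    next
      case False
      then obtain x where x: "h x = r" "x \<in> B" by auto
      have "measure N (B \<inter> h -` {r}) \<le> measure N (q -` {q x})"
      proof (rule finite_measure_mono)
        show "B \<inter> h -` {r} \<subseteq> q -` {q x}"
        proof
          fix y assume "y \<in> B \<inter> h -` {r}"
          then have "h y = h x" using x(1) by simp
          then show "y \<in> q -` {q x}" using h_eq[of y x] by simp
        qed
      qed (simp add: sN q)
      also have "\<dots> = 0" using x(2) mD[of "q x"] unfolding B_def I_def by simp
      finally have "measure N (B \<inter> h -` {r}) = 0" by (simp add: measure_le_0_iff)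
      then show ?thesis unfolding N'_def
        using pos hA sN by (subst measure_uniform_measure) (auto simp: emeasure_eq_measure)
    qed
    moreover have "sets N' = sets borel" by (simp add: N'_def sN)
    ultimately show False
      using borel_partition_not_atomless[OF N' _ hA] by blast
  qed
  then have "AE x in N. q x \<in> I"
    using B by (intro AE_I[of _ _ B]) (auto simp: B_def emeasure_eq_measure)
  moreover have "countable I" unfolding I_def by (rule D.countable_support)
  ultimately show ?thesis using that by blast
qed

text \<open>Sending a point to the first centre, in a well-order, whose ball contains it is a
  discrete-valued map, but arbitrary unions of its fibres need not be Borel. Stone's device replaces
  it by countably many partial maps all of whose preimages are Borel; each of them composed with
  \<open>k\<close> has almost surely countably many values.\<close>

lemma borel_map_AE_ball_cover:
  fixes N :: "'a::polish_space measure" and k :: "'a \<Rightarrow> 'b::metric_space"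
  assumes N: "finite_measure N" and sN: "sets N = sets borel"
    and k: "k \<in> borel_measurable borel" and e: "e > 0"
  obtains I where "countable I" "AE x in N. \<exists>h\<in>I. dist (k x) h < e"
proof -
  obtain r :: "('b \<times> 'b) set" where r: "well_order_on UNIV r"
    using well_order_on by blast
  then have wf: "wf (r - Id)" and lin: "linear_order_on UNIV r"
    by (auto simp: well_order_on_def)
  have "\<exists>h. dist x h < e \<and> (\<forall>h'. (h', h) \<in> r - Id \<longrightarrow> \<not> dist x h' < e)" for x
    using wfE_min[OF wf, of x "{h. dist x h < e}"] e by (metis dist_self mem_Collect_eq)
  then obtain q where q: "\<And>x. dist x (q x) < e"
      "\<And>x h'. (h', q x) \<in> r - Id \<Longrightarrow> \<not> dist x h' < e"
    by metis
  have q_le: "(q x, h) \<in> r \<or> q x = h" if "dist x h < e" for x h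
    using q(2)[of h x] that lin unfolding linear_order_on_def total_on_def by blast
  define d where "d n = inverse (real (Suc n))" for n
  have dpos: "d n > 0" for n by (simp add: d_def)
  \<comment> \<open>Points with a margin \<open>d n\<close> inside their first ball. Two of them
    closer than \<open>d n\<close> lie in each other's first ball, so neither centre can precede the
    other.\<close>
  define F where "F n = {x. ball x (d n) \<subseteq> ball (q x) e}" for n
  have qeq: "q x = q y" if "x \<in> F n" "y \<in> F n" "dist x y < d n" for x y n
  proof -
    have "dist y (q x) < e" "dist x (q y) < e"
      using that unfolding F_def by (auto simp: subset_iff dist_commute)
    then have "((q y, q x) \<in> r \<or> q x = q y) \<and> ((q x, q y) \<in> r \<or> q x = q y)"
      using q_le[of y "q x"] q_le[of x "q y"] by metis
    then show ?thesis
      using lin unfolding linear_order_on_def partial_order_on_def antisym_def by blast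
  qed
  \<comment> \<open>Points of F n closer than d n have the same q-value, so p n is locally constant where it is
    defined, and all its preimages are Borel.\<close>
  define p where "p n y = (if \<exists>x\<in>F n. dist x y < d n / 2
      then Some (q (SOME x. x \<in> F n \<and> dist x y < d n / 2)) else None)" for n y
  have p_eq: "p n y = Some (q x)" if "x \<in> F n" "dist x y < d n / 2" for n x y
  proof -
    define x' where "x' = (SOME x. x \<in> F n \<and> dist x y < d n / 2)"
    have x': "x' \<in> F n \<and> dist x' y < d n / 2"
      unfolding x'_def by (rule someI[where x=x]) (use that in blast)
    have "dist x' x < d n" using x' that dist_triangle3[of x' x y]
      by (metis dist_commute dist_triangle_half_l)
    then have "q x' = q x" using qeq x' that by blast
    then show ?thesis using that unfolding p_def x'_def[symmetric] by auto
  qed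
  have p_None: "p n y = None \<longleftrightarrow> (\<forall>x\<in>F n. \<not> dist x y < d n / 2)" for n y
    by (auto simp: p_def)
  have p_open: "open (p n -` (Some ` A))" for n A
  proof -
    have "p n -` (Some ` A) = (\<Union>x\<in>{x\<in>F n. q x \<in> A}. ball x (d n / 2))"
    proof (intro set_eqI iffI)
      fix y assume y: "y \<in> p n -` (Some ` A)"
      then have "p n y \<noteq> None" by auto
      then obtain x where "x \<in> F n" "dist x y < d n / 2" unfolding p_None by blast
      moreover from this have "q x \<in> A" using p_eq y by auto
      ultimately show "y \<in> (\<Union>x\<in>{x\<in>F n. q x \<in> A}. ball x (d n / 2))" by auto
    next
      fix y assume "y \<in> (\<Union>x\<in>{x\<in>F n. q x \<in> A}. ball x (d n / 2))"
      then show "y \<in> p n -` (Some ` A)" using p_eq by auto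
    qed
    then show ?thesis by auto
  qed
  have p_borel: "p n -` A \<in> sets borel" for n A
  proof -
    have "p n -` (Some ` UNIV) = {y. p n y \<noteq> None}" by auto
    then have 1: "{y. p n y = None} \<in> sets borel"
      using borel_open[OF p_open[of n UNIV]] borel_comp[of "{y. p n y \<noteq> None}"] by (simp add: Compl_eq)
    have "p n -` A = p n -` (Some ` {h. Some h \<in> A}) \<union> (if None \<in> A then {y. p n y = None} else {})"
      by (auto simp: image_iff) (metis not_None_eq)+
    then show ?thesis using 1 borel_open[OF p_open] by auto
  qed
  have "\<exists>I. countable I \<and> (AE x in N. p n (k x) \<in> I)" for n
  proof -
    have "(\<lambda>x. p n (k x)) -` A \<in> sets borel" for A
      using measurable_sets[OF k p_borel[of n A]] by (simp add: vimage_def)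
    from borel_partition_AE_countable[OF N sN this] show ?thesis by metis
  qed
  then obtain I where I: "\<And>n. countable (I n)" "\<And>n. AE x in N. p n (k x) \<in> I n" by metis
  have "AE x in N. \<forall>n. p n (k x) \<in> I n" using I(2) by (simp add: AE_all_countable)
  then have "AE x in N. \<exists>h\<in>(\<Union>n. the ` I n). dist (k x) h < e"
  proof eventually_elim
    case (elim x)
    have "open (ball (q (k x)) e)" "k x \<in> ball (q (k x)) e" using q(1) by (auto simp: dist_commute)
    then obtain s where s: "s > 0" "ball (k x) s \<subseteq> ball (q (k x)) e"
      using openE by blast
    then obtain n where "d n < s" unfolding d_def using reals_Archimedean by blast
    \<comment> \<open>A first ball is open, so every point has a positive margin and lies in some
      \<open>F n\<close>, where \<open>p n\<close> returns its true centre.\<close>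
    then have "k x \<in> F n" unfolding F_def using s(2) by auto
    then have "p n (k x) = Some (q (k x))" using p_eq[of "k x" n "k x"] dpos by simp
    then have "q (k x) \<in> the ` I n" using elim by (metis image_eqI option.sel)
    then show ?case using q(1) by blast
  qed
  moreover have "countable (\<Union>n. the ` I n)" using I(1) by auto
  ultimately show ?thesis using that by blast
qed

theorem borel_map_AE_separable:
  fixes N :: "'a::polish_space measure" and k :: "'a \<Rightarrow> 'b::metric_space"
  assumes "finite_measure N" "sets N = sets borel" "k \<in> borel_measurable borel"
  obtains e :: "nat \<Rightarrow> 'b" where "AE x in N. k x \<in> closure (range e)"
proof -
  have "\<exists>I. countable I \<and> (AE x in N. \<exists>h\<in>I. dist (k x) h < inverse (real (Suc n)))" for n
  proof -
    have "inverse (real (Suc n)) > 0" by simp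
    from borel_map_AE_ball_cover[OF assms this] show ?thesis by blast
  qed
  then obtain I where I: "\<And>n. countable (I n)"
      "\<And>n. AE x in N. \<exists>h\<in>I n. dist (k x) h < inverse (real (Suc n))"
    using choice[of "\<lambda>n I. countable I \<and> (AE x in N. \<exists>h\<in>I. dist (k x) h < inverse (real (Suc n)))"]
    by blast
  \<comment> \<open>The inserted value only makes \<open>J\<close> nonempty, as an enumeration by
    all naturals requires.\<close>
  define J where "J = insert undefined (\<Union>n. I n)"
  have J: "countable J" "J \<noteq> {}" unfolding J_def using I(1) by auto
  have "AE x in N. \<forall>n. \<exists>h\<in>I n. dist (k x) h < inverse (real (Suc n))"
    using I(2) by (simp add: AE_all_countable)
  then have "AE x in N. k x \<in> closure J"
  proof eventually_elim
    case (elim x)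
    show ?case unfolding closure_approachable
    proof (intro allI impI)
      fix e :: real assume "e > 0"
      then obtain n where "inverse (real (Suc n)) < e" using reals_Archimedean by blast
      moreover obtain h where "h \<in> I n" "dist (k x) h < inverse (real (Suc n))" using elim by blast
      ultimately show "\<exists>y\<in>J. dist y (k x) < e"
        by (intro bexI[of _ h]) (auto simp: J_def dist_commute)
    qed
  qed
  then show ?thesis
    using that[of "from_nat_into J"] range_from_nat_into[OF J(2,1)] by simp
qed

section \<open>Projections onto finite spans and weak measurability\<close>

text \<open>Gram-Schmidt form of the orthogonal projection onto the span of a list. If v already lies in
  the span of vs, the division is by 0 and the extra summand vanishes, as it should.\<close>
fun gs_proj :: "'h::real_inner list \<Rightarrow> 'h \<Rightarrow> 'h" where
  "gs_proj [] g = 0"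
| "gs_proj (v # vs) g =
     gs_proj vs g + (inner g (v - gs_proj vs v) /
       inner (v - gs_proj vs v) (v - gs_proj vs v)) *\<^sub>R (v - gs_proj vs v)"

lemma gs_proj_in_span: "gs_proj vs g \<in> span (set vs)"
proof (induction vs arbitrary: g)
  case (Cons v vs)
  have sub: "span (set vs) \<subseteq> span (set (v # vs))" by (intro span_mono) auto
  have "v \<in> span (set (v # vs))" by (intro span_base) simp
  then have "v - gs_proj vs v \<in> span (set (v # vs))"
    using Cons[of v] sub by (intro span_diff) auto
  then show ?case using Cons[of g] sub by (auto intro!: span_add span_scale)
qed (simp add: span_zero)

lemma orthogonal_span:
  assumes "\<And>z. z \<in> B \<Longrightarrow> inner (g :: 'h::real_inner) z = 0" "z \<in> span B"
  shows "inner g z = 0"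
  using assms(2) by (induction rule: span_induct_alt) (auto simp: inner_add_right assms(1))

lemma gs_proj_orthogonal: "z \<in> span (set vs) \<Longrightarrow> inner (g - gs_proj vs g) z = 0"
proof (induction vs arbitrary: g z)
  case (Cons v vs)
  define u where "u = v - gs_proj vs v"
  have pr: "gs_proj (v # vs) g = gs_proj vs g + (inner g u / inner u u) *\<^sub>R u"
    by (simp add: u_def)
  have u: "inner u z = 0" if "z \<in> span (set vs)" for z
    using Cons.IH[OF that, of v] by (simp add: u_def)
  have v: "v = u + gs_proj vs v" by (simp add: u_def)
  have "inner (g - gs_proj (v # vs) g) w = 0" if "w \<in> set (v # vs)" for w
  proof (cases "w = v")
    case True
    have 1: "inner (g - gs_proj vs g) (gs_proj vs v) = 0" "inner u (gs_proj vs v) = 0"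
      by (simp_all add: Cons.IH u gs_proj_in_span)
    have 2: "inner (gs_proj vs g) u = 0"
      using u[OF gs_proj_in_span] by (simp add: inner_commute)
    have "inner (g - gs_proj (v # vs) g) v = inner (g - gs_proj (v # vs) g) (u + gs_proj vs v)"
      using v by simp
    also have "\<dots> = 0"
      unfolding pr using 1 2
      by (simp add: inner_add_right inner_diff_left inner_add_left)
    finally show ?thesis using True by simp
  next
    case False
    then have "w \<in> span (set vs)" using that by (auto intro: span_base)
    then show ?thesis unfolding pr using Cons.IH[of w g] u[of w]
      by (simp add: inner_diff_left inner_add_left)
  qed
  then show ?case using Cons.prems by (rule orthogonal_span)
qed simp

text \<open>Orthogonality to the span determines the projection uniquely, so the choice operator
  returns the Gram-Schmidt value. This explicit form, built from inner products, makes measurability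
  accessible.\<close>

lemma orth_proj_span_list: "orth_proj (span (set vs)) g = gs_proj vs g"
  unfolding orth_proj_def
proof (rule some_equality)
  fix p assume p: "p \<in> span (set vs) \<and> (\<forall>z\<in>span (set vs). inner (g - p) z = 0)"
  then have d: "p - gs_proj vs g \<in> span (set vs)" using gs_proj_in_span by (auto intro: span_diff)
  have "inner (p - gs_proj vs g) (p - gs_proj vs g) =
      inner (g - gs_proj vs g) (p - gs_proj vs g) - inner (g - p) (p - gs_proj vs g)"
    by (simp add: inner_diff_left)
  also have "\<dots> = 0" using p d gs_proj_orthogonal by simp
  finally show "p = gs_proj vs g" by simp
qed (use gs_proj_in_span gs_proj_orthogonal in auto)

lemma gs_proj_nearest:
  assumes "z \<in> span (set vs)"
  shows "norm (g - gs_proj vs g) \<le> norm (g - z)"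
proof (rule power2_le_imp_le)
  have "gs_proj vs g - z \<in> span (set vs)" using assms gs_proj_in_span by (auto intro: span_diff)
  then have 0: "inner (g - gs_proj vs g) (gs_proj vs g - z) = 0" by (rule gs_proj_orthogonal)
  have "g - z = (g - gs_proj vs g) + (gs_proj vs g - z)" by simp
  then have "(norm (g - z))\<^sup>2 = (norm (g - gs_proj vs g))\<^sup>2 + (norm (gs_proj vs g - z))\<^sup>2"
    using 0 by (metis norm_add_Pythagorean orthogonal_def)
  then show "(norm (g - gs_proj vs g))\<^sup>2 \<le> (norm (g - z))\<^sup>2" by simp
qed simp

lemma infdist_span_list: "infdist g (span (set vs)) = norm (g - gs_proj vs g)"
proof (rule antisym)
  show "infdist g (span (set vs)) \<le> norm (g - gs_proj vs g)"
    using infdist_le[OF gs_proj_in_span, of g vs g] by (simp add: dist_norm)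
  show "norm (g - gs_proj vs g) \<le> infdist g (span (set vs))"
    using span_zero[of "set vs"] gs_proj_nearest[of _ vs g]
    by (auto simp: infdist_def dist_norm intro!: cINF_greatest)
qed

lemma norm_gs_proj_le: "norm (gs_proj vs g) \<le> norm g"
proof (rule power2_le_imp_le)
  have "inner (g - gs_proj vs g) (gs_proj vs g) = 0"
    using gs_proj_in_span by (rule gs_proj_orthogonal)
  then have "(norm ((g - gs_proj vs g) + gs_proj vs g))\<^sup>2 = (norm (g - gs_proj vs g))\<^sup>2 + (norm (gs_proj vs g))\<^sup>2"
    by (metis norm_add_Pythagorean orthogonal_def)
  then show "(norm (gs_proj vs g))\<^sup>2 \<le> (norm g)\<^sup>2" by simp
qed simp

lemma span_range_finite:
  assumes "y \<in> span (range (e :: nat \<Rightarrow> 'h::real_vector))"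
  obtains m where "y \<in> span (e ` {..<m})"
proof -
  have "\<exists>m. y \<in> span (e ` {..<m})"
    using assms
  proof (induction rule: span_induct_alt)
    case base
    then show ?case by (auto intro: span_zero)
  next
    case (step c x y)
    then obtain i m where i: "x = e i" "y \<in> span (e ` {..<m})" by auto
    have "y \<in> span (e ` {..<max m (Suc i)})"
      using i(2) by (rule rev_subsetD[OF _ span_mono]) auto
    moreover have "x \<in> span (e ` {..<max m (Suc i)})"
      using i(1) by (intro span_base) auto
    ultimately show ?case by (blast intro: span_add span_scale)
  qed
  then show ?thesis using that by blast
qed

text \<open>An approximant in the span uses finitely many \<open>e i\<close>; from that index on,
  the projection is at least as close.\<close>

lemma gs_proj_tendsto:
  fixes e :: "nat \<Rightarrow> 'h::real_inner"
  assumes "v \<in> closure (span (range e))"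
  shows "(\<lambda>n. gs_proj (map e [0..<n]) v) \<longlonglongrightarrow> v"
proof (rule metric_LIMSEQ_I)
  fix r :: real assume "r > 0"
  then obtain y where y: "y \<in> span (range e)" "dist y v < r"
    using assms closure_approachable by blast
  then obtain m where m: "y \<in> span (e ` {..<m})" using span_range_finite by blast
  have "dist (gs_proj (map e [0..<n]) v) v < r" if "n \<ge> m" for n
  proof -
    have "y \<in> span (set (map e [0..<n]))"
      using m by (rule rev_subsetD[OF _ span_mono]) (use that in auto)
    from gs_proj_nearest[OF this, of v] show ?thesis
      using y(2) by (simp add: dist_norm norm_minus_commute)
  qed
  then show "\<exists>no. \<forall>n\<ge>no. dist (gs_proj (map e [0..<n]) v) v < r" by blast
qed

text \<open>The type 'h is not second countable, so sums of Borel functions into it need not be Borel.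
  Scalar measurability is preserved by sums, and on a separable S it gives measurable norms.\<close>
definition weakly_measurable_in :: "'h::real_inner set \<Rightarrow> 'a measure \<Rightarrow> ('a \<Rightarrow> 'h) \<Rightarrow> bool" where
  "weakly_measurable_in S N f \<longleftrightarrow>
     (\<forall>a\<in>space N. f a \<in> S) \<and> (\<forall>h. (\<lambda>a. inner (f a) h) \<in> borel_measurable N)"

lemma weakly_measurable_in_compose:
  "weakly_measurable_in S N f \<Longrightarrow> p \<in> measurable N' N \<Longrightarrow> weakly_measurable_in S N' (\<lambda>a. f (p a))"
  unfolding weakly_measurable_in_def by (auto dest: measurable_space intro: measurable_compose)

lemma subspace_closure_span: "subspace (closure (span (B :: 'h::real_normed_vector set)))"
proof (rule subspaceI)
  show "0 \<in> closure (span B)" by (meson closure_subset span_zero subsetD)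
  fix x y assume xy: "x \<in> closure (span B)" "y \<in> closure (span B)"
  then obtain f g where f: "\<forall>n. f n \<in> span B" "f \<longlonglongrightarrow> x" and g: "\<forall>n. g n \<in> span B" "g \<longlonglongrightarrow> y"
    unfolding closure_sequential by blast
  then show "x + y \<in> closure (span B)"
    unfolding closure_sequential by (intro exI[of _ "\<lambda>n. f n + g n"]) (auto intro: span_add tendsto_add)
next
  fix c x assume "x \<in> closure (span B)"
  then obtain f where f: "\<forall>n. f n \<in> span B" "f \<longlonglongrightarrow> x"
    unfolding closure_sequential by blast
  then show "c *\<^sub>R x \<in> closure (span B)"
    unfolding closure_sequential by (intro exI[of _ "\<lambda>n. c *\<^sub>R f n"]) (auto intro: span_scale tendsto_scaleR)
qed

context
  fixes S :: "'h::real_inner set" and e :: "nat \<Rightarrow> 'h"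
  assumes S: "S = closure (span (range e))"
begin

lemma S_subspace: "subspace S"
  unfolding S by (rule subspace_closure_span)

lemma weakly_measurable_in_zero: "weakly_measurable_in S N (\<lambda>_. 0)"
  using subspace_0[OF S_subspace] by (simp add: weakly_measurable_in_def)

lemma weakly_measurable_in_add:
  "weakly_measurable_in S N f \<Longrightarrow> weakly_measurable_in S N g \<Longrightarrow> weakly_measurable_in S N (\<lambda>a. f a + g a)"
  using subspace_add[OF S_subspace] by (auto simp: weakly_measurable_in_def inner_add_left intro!: borel_measurable_add)

lemma weakly_measurable_in_scaleR:
  "weakly_measurable_in S N f \<Longrightarrow> c \<in> borel_measurable N \<Longrightarrow> weakly_measurable_in S N (\<lambda>a. c a *\<^sub>R f a)"
  using subspace_scale[OF S_subspace] by (auto simp: weakly_measurable_in_def intro!: borel_measurable_times)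

lemma weakly_measurable_in_diff:
  "weakly_measurable_in S N f \<Longrightarrow> weakly_measurable_in S N g \<Longrightarrow> weakly_measurable_in S N (\<lambda>a. f a - g a)"
  using subspace_diff[OF S_subspace] by (auto simp: weakly_measurable_in_def inner_diff_left intro!: borel_measurable_diff)

lemma weakly_measurable_in_gs_proj_const:
  assumes "weakly_measurable_in S N f" "weakly_measurable_in S N g"
  shows "(\<lambda>a. inner (gs_proj vs (f a)) (g a)) \<in> borel_measurable N"
proof (induction vs)
  case (Cons v vs)
  have "(\<lambda>a. inner (f a) h) \<in> borel_measurable N" "(\<lambda>a. inner h (g a)) \<in> borel_measurable N" for h
    using assms by (auto simp: weakly_measurable_in_def inner_commute[of h])
  then show ?case using Cons by (simp add: inner_add_left)
qed simp

text \<open>Projecting \<open>f a\<close> onto the first \<open>n\<close> vectors turns the inner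
  product into a finite sum of products of measurable scalars. The projections converge because
  \<open>f a\<close> lies in the closed span of the sequence; this is where separability
  enters.\<close>

lemma weakly_measurable_in_inner:
  assumes "weakly_measurable_in S N f" "weakly_measurable_in S N g"
  shows "(\<lambda>a. inner (f a) (g a)) \<in> borel_measurable N"
proof (rule borel_measurable_LIMSEQ_real)
  fix a assume "a \<in> space N"
  then have "f a \<in> closure (span (range e))" using assms by (auto simp: weakly_measurable_in_def S)
  then show "(\<lambda>n. inner (gs_proj (map e [0..<n]) (f a)) (g a)) \<longlonglongrightarrow> inner (f a) (g a)"
    by (intro tendsto_inner gs_proj_tendsto tendsto_const)
qed (rule weakly_measurable_in_gs_proj_const[OF assms])

lemma weakly_measurable_in_norm:
  assumes "weakly_measurable_in S N f"
  shows "(\<lambda>a. norm (f a)) \<in> borel_measurable N"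
  unfolding norm_eq_sqrt_inner using weakly_measurable_in_inner[OF assms assms] by simp

text \<open>The induction is generalised over \<open>g\<close> because the recursion projects the
  head vector as well as the argument.\<close>

lemma weakly_measurable_in_gs_proj:
  assumes "\<And>i. i \<in> set J \<Longrightarrow> weakly_measurable_in S N (v i)" "weakly_measurable_in S N g"
  shows "weakly_measurable_in S N (\<lambda>a. gs_proj (map (\<lambda>i. v i a) J) (g a))"
  using assms
proof (induction J arbitrary: g)
  case Nil
  then show ?case by (simp add: weakly_measurable_in_zero)
next
  case (Cons i J)
  have u: "weakly_measurable_in S N (\<lambda>a. v i a - gs_proj (map (\<lambda>i. v i a) J) (v i a))"
    using Cons.prems(1) by (intro weakly_measurable_in_diff Cons.IH) auto
  show ?case
    unfolding list.map gs_proj.simps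
    by (intro weakly_measurable_in_add weakly_measurable_in_scaleR u Cons.IH
        borel_measurable_divide weakly_measurable_in_inner Cons.prems) (auto intro: Cons.prems)
qed

end

section \<open>KOMP and the POLK recursion on sample indices\<close>

declare komp.simps [simp del]

lemma del_nth_map: "del_nth j (map x J) = map x (del_nth j J)"
  by (simp add: del_nth_def take_map drop_map)

lemma set_del_nth: "set (del_nth j J) \<subseteq> set J"
  unfolding del_nth_def using set_take_subset set_drop_subset by force

lemma length_del_nth: "j < length J \<Longrightarrow> length (del_nth j J) < length J"
  by (simp add: del_nth_def)

lemma HD_list: "HD k J = span (set (map k J))"
  by (simp add: HD_def)

lemma HD_map: "HD k (map x J) = HD (\<lambda>i. k (x i)) J"
  by (simp add: HD_def image_image)

lemma komp_err_list: "komp_err k g J j = norm (g - gs_proj (map k (del_nth j J)) g)"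
  unfolding komp_err_def HD_list infdist_span_list ..

text \<open>KOMP sees dictionary entries only through spans of feature vectors and selects by
  position, so it commutes with relabelling, even when samples repeat.\<close>

lemma komp_map: "komp k eps g (map x J) = map x (komp (\<lambda>i. k (x i)) eps g J)"
proof (induction J rule: length_induct)
  case (1 J)
  have err: "komp_err k g (map x J) = komp_err (\<lambda>i. k (x i)) g J"
    by (rule ext) (simp add: komp_err_def del_nth_map HD_map)
  then have idx: "komp_idx k g (map x J) = komp_idx (\<lambda>i. k (x i)) g J"
    by (simp add: komp_idx_def)
  show ?case
    using 1[rule_format, OF length_del_nth[of "komp_idx (\<lambda>i. k (x i)) g J" J]]
    by (subst (1 2) komp.simps) (simp add: Let_def err idx del_nth_map)
qed

lemma set_komp: "set (komp k eps g J) \<subseteq> set J"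
proof (induction J rule: length_induct)
  case (1 J)
  show ?case
    using 1[rule_format, OF length_del_nth[of "komp_idx k g J" J]] set_del_nth[of "komp_idx k g J" J]
    by (subst komp.simps) (auto simp: Let_def)
qed

lemma komp_cong: "(\<And>i. i \<in> set J \<Longrightarrow> v i = v' i) \<Longrightarrow> komp v eps g J = komp v' eps g J"
proof (induction J rule: length_induct)
  case (1 J)
  have map: "map v (del_nth j J) = map v' (del_nth j J)" for j
    using set_del_nth[of j J] 1(2) by auto
  have err: "komp_err v g J = komp_err v' g J"
    by (intro ext) (simp only: komp_err_list map)
  then have idx: "komp_idx v g J = komp_idx v' g J"
    by (simp add: komp_idx_def)
  have "komp v eps g (del_nth j J) = komp v' eps g (del_nth j J)" if "j < length J" for j
    using 1(1) length_del_nth[OF that] set_del_nth[of j J] 1(2) by blast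
  then show ?case
    by (subst (1 2) komp.simps) (simp add: Let_def err idx)
qed

text \<open>Every removal is tested against the original \<open>g\<close> and the full budget, so
  the errors of successive removals do not accumulate.\<close>

lemma infdist_HD_komp: "infdist g (HD k J) \<le> eps \<Longrightarrow> infdist g (HD k (komp k eps g J)) \<le> eps"
proof (induction J rule: length_induct)
  case (1 J)
  show ?case
    using 1(1)[rule_format, OF length_del_nth[of "komp_idx k g J" J]] 1(2)
    by (subst komp.simps) (auto simp: Let_def komp_err_def)
qed

text \<open>Storing sample indices instead of samples makes the dictionary a random variable with values
  in the countable type of lists of naturals.\<close>
lemma polk_index:
  "polk k l lam eta eps xs ys t =
     apsnd (map xs) (polk (\<lambda>s. k (xs s)) l lam eta eps (\<lambda>s. s) ys t)"
proof (induction t)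
  case (Suc t)
  have "xs t # [] = map xs [t]" by simp
  then show ?case
    using komp_map[of k _ _ xs "_ @ [t]"]
    by (simp add: Suc Let_def eval_rkhs_def HD_map)
qed simp

lemma polk_index_set: "set (snd (polk v l lam eta eps (\<lambda>s. s) ys t)) \<subseteq> {..<t}"
proof (induction t)
  case (Suc t)
  then show ?case
    using set_komp[of v _ _ "snd (polk v l lam eta eps (\<lambda>s. s) ys t) @ [t]"]
    by (fastforce simp: Let_def)
qed simp

text \<open>A run up to time \<open>t\<close> reads only the data of earlier indices. This serves
  twice: iterates are functions of the history, and \<open>k\<close> and \<open>l\<close> may be
  changed off the observed samples.\<close>

lemma polk_index_cong:
  assumes "\<And>s. s < t \<Longrightarrow> v s = v' s" "\<And>s z. s < t \<Longrightarrow> l z (ys s) = l' z (ys' s)"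
  shows "polk v l lam eta eps (\<lambda>s. s) ys t = polk v' l' lam eta eps (\<lambda>s. s) ys' t"
  using assms
proof (induction t)
  case (Suc t)
  define p where "p = polk v l lam eta eps (\<lambda>s. s) ys t"
  have p: "polk v' l' lam eta eps (\<lambda>s. s) ys' t = p"
    unfolding p_def using Suc by (metis less_SucI)
  have J: "set (snd p) \<subseteq> {..<t}" unfolding p_def by (rule polk_index_set)
  have l: "(\<lambda>z. l z (ys t)) = (\<lambda>z. l' z (ys' t))" using Suc.prems(2) by auto
  have k: "komp v eps' g (snd p @ [t]) = komp v' eps' g (snd p @ [t])" for eps' g
    using J Suc.prems(1) by (intro komp_cong) (auto simp: subset_iff)
  have "map v (komp v' eps' g (snd p @ [t])) = map v' (komp v' eps' g (snd p @ [t]))" for eps' g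
  proof (rule map_cong[OF refl])
    fix i assume "i \<in> set (komp v' eps' g (snd p @ [t]))"
    then have "i \<in> set (snd p @ [t])" by (rule subsetD[OF set_komp])
    then show "v i = v' i" using J Suc.prems(1) by auto
  qed
  then have "HD v (komp v' eps' g (snd p @ [t])) = HD v' (komp v' eps' g (snd p @ [t]))" for eps' g
    unfolding HD_list by simp
  then show ?case
    unfolding polk.simps p p_def[symmetric] Let_def k l eval_rkhs_def
    using Suc.prems(1)[of t] by simp
qed simp

lemma orth_proj_HD: "orth_proj (HD v J) g = gs_proj (map v J) g"
  unfolding HD_list orth_proj_span_list ..

context
  fixes S :: "'h::real_inner set" and e :: "nat \<Rightarrow> 'h"
  assumes S: "S = closure (span (range e))"
begin

text \<open>For a fixed list the selected index is random but ranges over a countable set. Freezing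
  it leaves a shorter fixed list, to which the induction hypothesis applies.\<close>

lemma measurable_komp:
  assumes v: "\<And>i. weakly_measurable_in S N (v i)" and g: "weakly_measurable_in S N g"
  shows "(\<lambda>a. komp (\<lambda>i. v i a) eps (g a) (J :: nat list)) \<in> measurable N (count_space UNIV)"
proof (induction J rule: length_induct)
  case (1 J)
  have err[measurable]: "(\<lambda>a. komp_err (\<lambda>i. v i a) (g a) J j) \<in> borel_measurable N" for j
    unfolding komp_err_list
    by (intro weakly_measurable_in_norm[OF S] weakly_measurable_in_diff[OF S]
        weakly_measurable_in_gs_proj[OF S] v g)
  have idx[measurable]: "(\<lambda>a. komp_idx (\<lambda>i. v i a) (g a) J) \<in> measurable N (count_space UNIV)"
    unfolding komp_idx_def by measurable
  have pr: "Measurable.pred N (\<lambda>a. komp_err (\<lambda>i. v i a) (g a) J (komp_idx (\<lambda>i. v i a) (g a) J) \<le> eps)"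
    by (rule measurable_compose_countable[OF _ idx]) measurable
  have rec: "(\<lambda>a. if komp_idx (\<lambda>i. v i a) (g a) J < length J
      then komp (\<lambda>i. v i a) eps (g a) (del_nth (komp_idx (\<lambda>i. v i a) (g a) J) J) else J)
      \<in> measurable N (count_space UNIV)"
  proof (rule measurable_compose_countable[OF _ idx])
    fix j :: nat
    show "(\<lambda>a. if j < length J then komp (\<lambda>i. v i a) eps (g a) (del_nth j J) else J)
        \<in> measurable N (count_space UNIV)"
      using 1[rule_format, OF length_del_nth[of j J]] by (cases "j < length J") auto
  qed
  have "(\<lambda>a. komp (\<lambda>i. v i a) eps (g a) J) =
    (\<lambda>a. if J \<noteq> [] \<and> komp_err (\<lambda>i. v i a) (g a) J (komp_idx (\<lambda>i. v i a) (g a) J) \<le> eps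
       then (if komp_idx (\<lambda>i. v i a) (g a) J < length J
      then komp (\<lambda>i. v i a) eps (g a) (del_nth (komp_idx (\<lambda>i. v i a) (g a) J) J) else J) else J)"
    by (rule ext, subst komp.simps) (auto simp: Let_def)
  also have "\<dots> \<in> measurable N (count_space UNIV)"
    using pr rec by measurable
  finally show ?case .
qed

text \<open>Iterate and dictionary are carried together: the dictionary has countably many values,
  so it can be frozen, and for each frozen list the projection is covered by
  \<open>weakly_measurable_in_gs_proj\<close>.\<close>

lemma measurable_polk_index:
  assumes v: "\<And>i. weakly_measurable_in S N (v i)" and y[measurable]: "\<And>i. y i \<in> borel_measurable N"
    and l: "(\<lambda>(z, y). deriv (\<lambda>z. l z y) z) \<in> borel_measurable (borel \<Otimes>\<^sub>M borel)"
  shows "weakly_measurable_in S N (\<lambda>a. fst (polk (\<lambda>i. v i a) l lam eta eps (\<lambda>s. s) (\<lambda>i. y i a) t)) \<and>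
    (\<lambda>a. snd (polk (\<lambda>i. v i a) l lam eta eps (\<lambda>s. s) (\<lambda>i. y i a) t)) \<in> measurable N (count_space UNIV)"
proof (induction t)
  case 0
  then show ?case by (simp add: weakly_measurable_in_zero[OF S])
next
  case (Suc t)
  define f where "f a = fst (polk (\<lambda>i. v i a) l lam eta eps (\<lambda>s. s) (\<lambda>i. y i a) t)" for a
  define D where "D a = snd (polk (\<lambda>i. v i a) l lam eta eps (\<lambda>s. s) (\<lambda>i. y i a) t)" for a
  have f: "weakly_measurable_in S N f" and D[measurable]: "D \<in> measurable N (count_space UNIV)"
    using Suc unfolding f_def D_def by auto
  have [measurable]: "(\<lambda>a. inner (f a) (v t a)) \<in> borel_measurable N"
    by (intro weakly_measurable_in_inner[OF S] f v)
  have dl: "(\<lambda>a. deriv (\<lambda>z. l z (y t a)) (inner (f a) (v t a))) \<in> borel_measurable N"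
    using measurable_compose[OF _ l, of "\<lambda>a. (inner (f a) (v t a), y t a)" N] by simp
  define g where "g a = (1 - eta t * lam) *\<^sub>R f a
               - (eta t * deriv (\<lambda>z. l z (y t a)) (inner (f a) (v t a))) *\<^sub>R v t a" for a
  have g: "weakly_measurable_in S N g"
    unfolding g_def using dl
    by (intro weakly_measurable_in_diff[OF S] weakly_measurable_in_scaleR[OF S] f v) auto
  define D' where "D' a = komp (\<lambda>i. v i a) (eps t) (g a) (D a @ [t])" for a
  have D': "D' \<in> measurable N (count_space UNIV)"
    unfolding D'_def by (rule measurable_compose_countable[OF _ D]) (rule measurable_komp[OF v g])
  have pr: "weakly_measurable_in S N (\<lambda>a. gs_proj (map (\<lambda>i. v i a) J) (g a))" for J
    by (intro weakly_measurable_in_gs_proj[OF S] v g)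
  have "weakly_measurable_in S N (\<lambda>a. gs_proj (map (\<lambda>i. v i a) (D' a)) (g a))"
    unfolding weakly_measurable_in_def
  proof (intro conjI allI ballI)
    show "(\<lambda>a. inner (gs_proj (map (\<lambda>i. v i a) (D' a)) (g a)) h) \<in> borel_measurable N" for h
    proof (rule measurable_compose_countable[OF _ D'])
      show "(\<lambda>a. inner (gs_proj (map (\<lambda>i. v i a) J) (g a)) h) \<in> borel_measurable N" for J
        using pr[of J] by (simp add: weakly_measurable_in_def)
    qed
  qed (use pr in \<open>auto simp: weakly_measurable_in_def\<close>)
  moreover have "polk (\<lambda>i. v i a) l lam eta eps (\<lambda>s. s) (\<lambda>i. y i a) (Suc t) =
      (gs_proj (map (\<lambda>i. v i a) (D' a)) (g a), D' a)" for a
    by (simp add: Let_def eval_rkhs_def orth_proj_HD D'_def D_def g_def f_def)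
  ultimately show ?case using D' by simp
qed

end

text \<open>For the norm bound it only matters that the new iterate is a projection of the gradient
  step, not onto which span.\<close>

lemma polk_Suc_obtain:
  obtains vs where
    "fst (polk k l lam eta eps xs ys (Suc t)) = gs_proj vs
      ((1 - eta t * lam) *\<^sub>R fst (polk k l lam eta eps xs ys t)
       - (eta t * deriv (\<lambda>z. l z (ys t)) (inner (fst (polk k l lam eta eps xs ys t)) (k (xs t)))) *\<^sub>R k (xs t))"
  by (simp add: Let_def eval_rkhs_def orth_proj_HD)

lemma polk_in_HD: "fst (polk k l lam eta eps xs ys t) \<in> HD k (snd (polk k l lam eta eps xs ys t))"
proof (cases t)
  case (Suc s)
  then show ?thesis
    by (simp add: Let_def orth_proj_HD) (simp only: HD_list gs_proj_in_span)
qed (simp add: HD_def)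

text \<open>The gradient step lies in the span of the old dictionary and the new sample, so KOMP
  starts with error 0 and \<open>infdist_HD_komp\<close> applies.\<close>

lemma polk_step_error:
  assumes "eps t \<ge> 0"
  shows "norm (fst (polk k l lam eta eps xs ys (Suc t)) -
      ((1 - eta t * lam) *\<^sub>R fst (polk k l lam eta eps xs ys t)
       - (eta t * deriv (\<lambda>z. l z (ys t)) (inner (fst (polk k l lam eta eps xs ys t)) (k (xs t)))) *\<^sub>R k (xs t)))
    \<le> eps t" (is "norm (_ - ?g) \<le> _")
proof -
  define D where "D = snd (polk k l lam eta eps xs ys t)"
  have "fst (polk k l lam eta eps xs ys t) \<in> HD k (D @ [xs t])"
    using polk_in_HD unfolding D_def HD_def by (rule rev_subsetD[OF _ span_mono]) auto
  moreover have "k (xs t) \<in> HD k (D @ [xs t])" unfolding HD_def by (intro span_base) auto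
  ultimately have "?g \<in> HD k (D @ [xs t])"
    unfolding HD_def by (intro span_diff span_scale)
  then have "infdist ?g (HD k (D @ [xs t])) \<le> eps t" using assms by simp
  then have "infdist ?g (HD k (komp k (eps t) ?g (D @ [xs t]))) \<le> eps t"
    by (rule infdist_HD_komp)
  then show ?thesis
    unfolding HD_list infdist_span_list
    by (simp add: Let_def eval_rkhs_def orth_proj_HD D_def norm_minus_commute)
qed

section \<open>Almost sure convergence\<close>

text \<open>The errors have no sign and may converge only conditionally, so their partial sums are
  subtracted from \<open>V\<close>; the result is decreasing and bounded below. A positive limit of
  \<open>V\<close> would make the decrements dominate a multiple of \<open>eta\<close> and hence
  make \<open>eta\<close> summable.\<close>

lemma perturbed_descent_tendsto_0:
  fixes V eta e :: "nat \<Rightarrow> real"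
  assumes V: "\<And>t. V t \<ge> 0" and eta: "\<And>t. eta t \<ge> 0" and div: "\<not> summable eta"
    and e: "convergent (\<lambda>n. \<Sum>t<n. e t)" and lam: "lam > 0"
    and step: "\<And>t. V (Suc t) \<le> V t - lam * eta t * V t + e t"
  shows "V \<longlonglongrightarrow> 0"
proof -
  define E where "E n = (\<Sum>t<n. e t)" for n
  obtain L where L: "E \<longlonglongrightarrow> L" using e unfolding E_def convergent_def by blast
  then obtain b where b: "\<And>n. \<bar>E n\<bar> \<le> b"
    using convergent_imp_Bseq[of E] unfolding convergent_def Bseq_def real_norm_def by blast
  define U where "U n = V n - E n" for n
  have U_step: "U (Suc t) \<le> U t - lam * eta t * V t" for t
    using step[of t] by (simp add: U_def E_def)
  have prod_nonneg: "lam * eta t * V t \<ge> 0" for t using V eta lam by (intro mult_nonneg_nonneg) auto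
  have U_low: "U n \<ge> - b" for n using V[of n] b[of n] by (simp add: U_def abs_le_iff)
  have "decseq U"
  proof (rule decseq_SucI)
    show "U (Suc n) \<le> U n" for n using U_step[of n] prod_nonneg[of n] by linarith
  qed
  then obtain u where u: "U \<longlonglongrightarrow> u" using decseq_convergent[of U "- b"] U_low by blast
  have V_lim: "V \<longlonglongrightarrow> u + L"
    using tendsto_add[OF u L] by (simp add: U_def)
  have sum_le: "(\<Sum>t<n. lam * eta t * V t) \<le> U 0 - U n" for n
  proof (induction n)
    case (Suc n) then show ?case using U_step[of n] by simp
  qed simp
  have "u + L \<ge> 0" using LIMSEQ_le_const[OF V_lim] V by blast
  moreover have "\<not> u + L > 0"
  proof
    assume pos: "u + L > 0"
    define r where "r = (u + L) / 2"
    have r: "r > 0" "r < u + L" using pos by (auto simp: r_def)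
    obtain N where N: "\<And>n. n \<ge> N \<Longrightarrow> V n > r"
      using order_tendstoD(1)[OF V_lim r(2)] unfolding eventually_sequentially by blast
    have "summable (\<lambda>t. lam * eta t * V t)"
    proof (rule summableI_nonneg_bounded[where x="U 0 + b"])
      show "(\<Sum>t<n. lam * eta t * V t) \<le> U 0 + b" for n
        using sum_le[of n] U_low[of n] by linarith
    qed (rule prod_nonneg)
    then have "summable (\<lambda>t. (lam * eta t * V t) / (lam * r))" by (rule summable_divide)
    then have "summable eta"
    proof (rule summable_comparison_test')
      fix n assume "n \<ge> N"
      then have "eta n * r \<le> eta n * V n" using N[of n] eta[of n] by (intro mult_left_mono) auto
      then show "norm (eta n) \<le> lam * eta n * V n / (lam * r)"
        using eta[of n] lam r by (simp add: field_simps)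
    qed
    with div show False by blast
  qed
  ultimately have "u + L = 0" by linarith
  then show ?thesis using V_lim by simp
qed

section \<open>A Kolmogorov maximal inequality for bounded orthogonal differences\<close>

definition window_sum :: "nat \<Rightarrow> nat \<Rightarrow> (nat \<Rightarrow> real) \<Rightarrow> real" where
  "window_sum m n x = (\<Sum>t\<in>{m..<n}. x t)"

text \<open>A numerical indicator, so that it can weight increments. It depends on
  \<open>x s\<close> for \<open>s < n\<close> only, hence the weight of step \<open>n\<close> is
  known before that step.\<close>

definition below :: "nat \<Rightarrow> real \<Rightarrow> nat \<Rightarrow> (nat \<Rightarrow> real) \<Rightarrow> real" where
  "below m \<epsilon> n x = (if \<forall>j\<in>{m..n}. \<bar>window_sum m j x\<bar> < \<epsilon> then 1 else 0)"

text \<open>The sum from m on, stopped when it first leaves the interval from -eps to eps.\<close>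
definition stopped_sum :: "nat \<Rightarrow> real \<Rightarrow> nat \<Rightarrow> (nat \<Rightarrow> real) \<Rightarrow> real" where
  "stopped_sum m \<epsilon> n x = (\<Sum>t\<in>{m..<n}. below m \<epsilon> t x * x t)"

lemma window_sum_cong: "(\<And>s. s < n \<Longrightarrow> x s = y s) \<Longrightarrow> window_sum m n x = window_sum m n y"
  by (simp add: window_sum_def)

lemma below_cong:
  assumes "\<And>s. s < n \<Longrightarrow> x s = y s"
  shows "below m \<epsilon> n x = below m \<epsilon> n y"
proof -
  have "window_sum m j x = window_sum m j y" if "j \<in> {m..n}" for j
    using that assms by (intro window_sum_cong) auto
  then show ?thesis by (simp add: below_def)
qed

lemma stopped_sum_cong:
  assumes "\<And>s. s < n \<Longrightarrow> x s = y s"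
  shows "stopped_sum m \<epsilon> n x = stopped_sum m \<epsilon> n y"
  unfolding stopped_sum_def
proof (rule sum.cong[OF refl])
  fix t assume "t \<in> {m..<n}"
  then show "below m \<epsilon> t x * x t = below m \<epsilon> t y * y t"
    using assms below_cong[of t x y] by auto
qed

lemma below_01: "0 \<le> below m \<epsilon> n x" "below m \<epsilon> n x \<le> 1" "below m \<epsilon> n x * below m \<epsilon> n x = below m \<epsilon> n x"
  by (auto simp: below_def)

text \<open>The weight of step \<open>t\<close> inspects sums that end before \<open>t\<close>, so
  the increment by which the sum leaves the interval is still counted. All later weights vanish, and
  the stopped sum stays at its exit value.\<close>

lemma abs_stopped_sum_ge:
  assumes "j \<in> {m..n}" "\<bar>window_sum m j x\<bar> \<ge> \<epsilon>"
  shows "\<bar>stopped_sum m \<epsilon> n x\<bar> \<ge> \<epsilon>"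
proof -
  define i where "i = (LEAST i. i \<ge> m \<and> \<bar>window_sum m i x\<bar> \<ge> \<epsilon>)"
  have i: "i \<ge> m" "\<bar>window_sum m i x\<bar> \<ge> \<epsilon>" "i \<le> j"
    using LeastI[of "\<lambda>i. i \<ge> m \<and> \<bar>window_sum m i x\<bar> \<ge> \<epsilon>" j] Least_le[of "\<lambda>i. i \<ge> m \<and> \<bar>window_sum m i x\<bar> \<ge> \<epsilon>" j]
      assms unfolding i_def by auto
  have less: "\<bar>window_sum m s x\<bar> < \<epsilon>" if "m \<le> s" "s < i" for s
    using not_less_Least[of s "\<lambda>i. i \<ge> m \<and> \<bar>window_sum m i x\<bar> \<ge> \<epsilon>"] that unfolding i_def by auto
  have "stopped_sum m \<epsilon> n x = (\<Sum>t\<in>{m..<n}. if t < i then x t else 0)"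
    unfolding stopped_sum_def
  proof (rule sum.cong[OF refl])
    fix t assume t: "t \<in> {m..<n}"
    show "below m \<epsilon> t x * x t = (if t < i then x t else 0)"
    proof (cases "t < i")
      case True
      then show ?thesis using less by (auto simp: below_def)
    next
      case False
      then have "i \<in> {m..t}" using i by auto
      then have "below m \<epsilon> t x = 0" using i(2) unfolding below_def by (auto simp: not_less)
      then show ?thesis using False by simp
    qed
  qed
  also have "\<dots> = (\<Sum>t\<in>{m..<i}. x t)"
    by (rule sum.mono_neutral_cong_right) (use i assms in auto)
  finally show ?thesis using i(2) by (simp add: window_sum_def)
qed

context prob_space
begin

context
  fixes d :: "nat \<Rightarrow> 'a \<Rightarrow> real" and c :: "nat \<Rightarrow> real"
  assumes d[measurable]: "\<And>t. d t \<in> borel_measurable M"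
    and bound: "\<And>t w. w \<in> space M \<Longrightarrow> \<bar>d t w\<bar> \<le> c t"
    and c: "summable (\<lambda>t. (c t)\<^sup>2)"
    and orth: "\<And>t g K. g \<in> borel_measurable (PiM {..<t} (\<lambda>_. borel)) \<Longrightarrow>
        (\<And>w. w \<in> space M \<Longrightarrow> \<bar>g (\<lambda>s\<in>{..<t}. d s w)\<bar> \<le> K) \<Longrightarrow>
        expectation (\<lambda>w. g (\<lambda>s\<in>{..<t}. d s w) * d t w) = 0"
begin

lemma measurable_window_sum [measurable]: "(\<lambda>w. window_sum m n (\<lambda>s. d s w)) \<in> borel_measurable M"
  unfolding window_sum_def by measurable

lemma measurable_below [measurable]: "(\<lambda>w. below m \<epsilon> n (\<lambda>s. d s w)) \<in> borel_measurable M"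
  unfolding below_def by measurable

lemma measurable_stopped_sum [measurable]: "(\<lambda>w. stopped_sum m \<epsilon> n (\<lambda>s. d s w)) \<in> borel_measurable M"
  unfolding stopped_sum_def by measurable

text \<open>Prepares the test function for \<open>orth\<close>: it must be a function of the
  differences before time \<open>n\<close> alone.\<close>

lemma measurable_stopped_PiM:
  "(\<lambda>x. stopped_sum m \<epsilon> n x * below m \<epsilon> n x) \<in> borel_measurable (PiM {..<n} (\<lambda>_. borel))"
proof -
  have comp: "(\<lambda>x. x t) \<in> borel_measurable (PiM {..<n} (\<lambda>_. borel :: real measure))" if "t < n" for t
    using that by (intro measurable_component_singleton) auto
  have w: "window_sum m j \<in> borel_measurable (PiM {..<n} (\<lambda>_. borel))" if "j \<le> n" for j
    unfolding window_sum_def using that by (intro borel_measurable_sum comp) auto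
  have b: "below m \<epsilon> j \<in> borel_measurable (PiM {..<n} (\<lambda>_. borel))" if "j \<le> n" for j
    unfolding below_def
  proof (rule measurable_If)
    show "{x \<in> space (PiM {..<n} (\<lambda>_. borel)). \<forall>i\<in>{m..j}. \<bar>window_sum m i x\<bar> < \<epsilon>} \<in> sets (PiM {..<n} (\<lambda>_. borel))"
      using that by (intro sets.sets_Collect_finite_All borel_measurable_less borel_measurable_abs w) auto
  qed auto
  show ?thesis
    using comp b unfolding stopped_sum_def by (intro borel_measurable_times borel_measurable_sum) auto
qed

lemma martingale_bound_nonneg: "c t \<ge> 0"
  using not_empty bound by (meson abs_ge_zero ex_in_conv order_trans)

lemma abs_stopped_sum_le:
  assumes "w \<in> space M"
  shows "\<bar>stopped_sum m \<epsilon> n (\<lambda>s. d s w)\<bar> \<le> (\<Sum>t\<in>{m..<n}. c t)"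
  unfolding stopped_sum_def
proof (rule order_trans[OF sum_abs sum_mono])
  fix t
  have "\<bar>below m \<epsilon> t (\<lambda>s. d s w) * d t w\<bar> \<le> 1 * c t"
    unfolding abs_mult using below_01 bound[OF assms] by (intro mult_mono) auto
  then show "\<bar>below m \<epsilon> t (\<lambda>s. d s w) * d t w\<bar> \<le> c t" by simp
qed

text \<open>In the square of one more summand the cross term is the new difference times a bounded
  function of the earlier ones, so \<open>orth\<close> removes it; the squared increment adds at
  most \<open>(c n)^2\<close>.\<close>

lemma expectation_stopped_sum_sq_le:
  "expectation (\<lambda>w. (stopped_sum m \<epsilon> n (\<lambda>s. d s w))\<^sup>2) \<le> (\<Sum>t\<in>{m..<n}. (c t)\<^sup>2)"
proof (induction n)
  case 0
  then show ?case by (simp add: stopped_sum_def)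
next
  case (Suc n)
  show ?case
  proof (cases "m \<le> n")
    case False
    then show ?thesis by (simp add: stopped_sum_def)
  next
    case True
    let ?T = "\<lambda>w. stopped_sum m \<epsilon> n (\<lambda>s. d s w)" and ?b = "\<lambda>w. below m \<epsilon> n (\<lambda>s. d s w)"
    let ?K = "\<Sum>t\<in>{m..<n}. c t"
    have K: "?K \<ge> 0" by (intro sum_nonneg martingale_bound_nonneg)
    have Tb: "\<bar>?T w * ?b w\<bar> \<le> ?K" if "w \<in> space M" for w
      unfolding abs_mult using abs_stopped_sum_le[OF that, of m \<epsilon> n] below_01[of m \<epsilon> n] K
      by (metis abs_of_nonneg mult.right_neutral mult_mono abs_ge_zero)
    have eq: "(stopped_sum m \<epsilon> (Suc n) (\<lambda>s. d s w))\<^sup>2 = (?T w)\<^sup>2 + 2 * (?T w * ?b w * d n w) + ?b w * (d n w)\<^sup>2" for w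
    proof -
      have "stopped_sum m \<epsilon> (Suc n) (\<lambda>s. d s w) = ?T w + ?b w * d n w"
        using True by (simp add: stopped_sum_def)
      then have "(stopped_sum m \<epsilon> (Suc n) (\<lambda>s. d s w))\<^sup>2 = (?T w)\<^sup>2 + 2 * (?T w * ?b w * d n w) + (?b w * ?b w) * (d n w)\<^sup>2"
        by (simp add: power2_eq_square algebra_simps)
      then show ?thesis by (simp only: below_01(3))
    qed
    have dn: "(d n w)\<^sup>2 \<le> (c n)\<^sup>2" if "w \<in> space M" for w
      using bound[OF that, of n] martingale_bound_nonneg[of n] by (simp add: abs_le_square_iff[symmetric])
    have bd: "?b w * (d n w)\<^sup>2 \<le> (c n)\<^sup>2" if "w \<in> space M" for w
    proof -
      have "?b w * (d n w)\<^sup>2 \<le> 1 * (c n)\<^sup>2"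
        using dn[OF that] below_01(1,2) by (intro mult_mono) auto
      then show ?thesis by simp
    qed
    have i1: "integrable M (\<lambda>w. (?T w)\<^sup>2)"
    proof (rule integrable_const_bound[where B="?K\<^sup>2"])
      show "AE w in M. norm ((?T w)\<^sup>2) \<le> ?K\<^sup>2"
        using abs_stopped_sum_le K by (intro AE_I2) (simp add: abs_le_square_iff[symmetric])
    qed measurable
    have i2: "integrable M (\<lambda>w. ?T w * ?b w * d n w)"
    proof (rule integrable_const_bound[where B="?K * c n"])
      show "AE w in M. norm (?T w * ?b w * d n w) \<le> ?K * c n"
        unfolding norm_mult[of "_ * _"] real_norm_def abs_mult[of "_ * _" "d n _"]
        using Tb bound K by (intro AE_I2 mult_mono) auto
    qed measurable
    have i3: "integrable M (\<lambda>w. ?b w * (d n w)\<^sup>2)"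
    proof (rule integrable_const_bound[where B="(c n)\<^sup>2"])
      show "AE w in M. norm (?b w * (d n w)\<^sup>2) \<le> (c n)\<^sup>2"
        using bd below_01(1) by (intro AE_I2) (simp add: abs_mult)
    qed measurable
    have "stopped_sum m \<epsilon> n (\<lambda>s\<in>{..<n}. d s w) = ?T w" "below m \<epsilon> n (\<lambda>s\<in>{..<n}. d s w) = ?b w" for w
      by (rule stopped_sum_cong, simp) (rule below_cong, simp)
    then have zero: "expectation (\<lambda>w. ?T w * ?b w * d n w) = 0"
      using orth[OF measurable_stopped_PiM, of m \<epsilon> n ?K] Tb by simp
    have "expectation (\<lambda>w. ?b w * (d n w)\<^sup>2) \<le> expectation (\<lambda>w. (c n)\<^sup>2)"
      by (rule integral_mono[OF i3]) (use bd in auto)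
    also have "\<dots> = (c n)\<^sup>2" by (simp add: prob_space)
    finally have "expectation (\<lambda>w. ?b w * (d n w)\<^sup>2) \<le> (c n)\<^sup>2" .
    moreover have "expectation (\<lambda>w. (stopped_sum m \<epsilon> (Suc n) (\<lambda>s. d s w))\<^sup>2) =
        expectation (\<lambda>w. (?T w)\<^sup>2) + 2 * expectation (\<lambda>w. ?T w * ?b w * d n w) + expectation (\<lambda>w. ?b w * (d n w)\<^sup>2)"
      unfolding eq using i1 i2 i3 by simp
    ultimately show ?thesis using Suc zero True by simp
  qed
qed

text \<open>Markov's inequality for the squared stopped sum bounds the exit probability up to time
  \<open>n\<close> by a tail of the series, independently of \<open>n\<close>; the exit events
  increase with \<open>n\<close>.\<close>

lemma maximal_inequality:
  assumes "\<epsilon> > 0"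
  shows "prob {w \<in> space M. \<exists>j\<ge>m. \<bar>window_sum m j (\<lambda>s. d s w)\<bar> \<ge> \<epsilon>}
     \<le> ((\<Sum>t. (c t)\<^sup>2) - (\<Sum>t<m. (c t)\<^sup>2)) / \<epsilon>\<^sup>2"
proof -
  let ?A = "\<lambda>n. {w \<in> space M. \<exists>j\<in>{m..n}. \<bar>window_sum m j (\<lambda>s. d s w)\<bar> \<ge> \<epsilon>}"
  let ?R = "((\<Sum>t. (c t)\<^sup>2) - (\<Sum>t<m. (c t)\<^sup>2))"
  have A: "prob (?A n) \<le> ?R / \<epsilon>\<^sup>2" for n
  proof -
    let ?T = "\<lambda>w. stopped_sum m \<epsilon> n (\<lambda>s. d s w)"
    have int: "integrable M (\<lambda>w. (?T w)\<^sup>2)"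
    proof (rule integrable_const_bound[where B="(\<Sum>t\<in>{m..<n}. c t)\<^sup>2"])
      have "(\<Sum>t\<in>{m..<n}. c t) \<ge> 0" by (intro sum_nonneg martingale_bound_nonneg)
      then show "AE w in M. norm ((?T w)\<^sup>2) \<le> (\<Sum>t\<in>{m..<n}. c t)\<^sup>2"
        using abs_stopped_sum_le by (intro AE_I2) (simp add: abs_le_square_iff[symmetric])
    qed measurable
    have "prob (?A n) \<le> prob {w \<in> space M. (?T w)\<^sup>2 \<ge> \<epsilon>\<^sup>2}"
    proof (rule finite_measure_mono)
      show "?A n \<subseteq> {w \<in> space M. (?T w)\<^sup>2 \<ge> \<epsilon>\<^sup>2}"
      proof safe
        fix w j assume "j \<in> {m..n}" "\<bar>window_sum m j (\<lambda>s. d s w)\<bar> \<ge> \<epsilon>"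
        then have "\<bar>?T w\<bar> \<ge> \<epsilon>" by (rule abs_stopped_sum_ge)
        then show "(?T w)\<^sup>2 \<ge> \<epsilon>\<^sup>2" using assms by (simp add: abs_le_square_iff[symmetric])
      qed
    qed measurable
    also have "\<dots> \<le> expectation (\<lambda>w. (?T w)\<^sup>2) / \<epsilon>\<^sup>2"
      using integral_Markov_inequality_measure[OF int, of "space M" "\<epsilon>\<^sup>2"] assms by simp
    also have "\<dots> \<le> ?R / \<epsilon>\<^sup>2"
    proof (rule divide_right_mono)
      have "(\<Sum>t\<in>{m..<n}. (c t)\<^sup>2) \<le> ?R"
      proof (cases "m \<le> n")
        case True
        have "(\<Sum>t<n. (c t)\<^sup>2) = (\<Sum>t<m. (c t)\<^sup>2) + (\<Sum>t\<in>{m..<n}. (c t)\<^sup>2)"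
          using True by (metis lessThan_atLeast0 sum.atLeastLessThan_concat zero_le)
        moreover have "(\<Sum>t<n. (c t)\<^sup>2) \<le> (\<Sum>t. (c t)\<^sup>2)" using c by (intro sum_le_suminf) auto
        ultimately show ?thesis by linarith
      next
        case False
        have "(\<Sum>t<m. (c t)\<^sup>2) \<le> (\<Sum>t. (c t)\<^sup>2)" using c by (intro sum_le_suminf) auto
        then show ?thesis using False by simp
      qed
      then show "expectation (\<lambda>w. (?T w)\<^sup>2) \<le> ?R"
        using expectation_stopped_sum_sq_le order_trans by blast
    qed simp
    finally show ?thesis .
  qed
  have "(\<lambda>n. prob (?A n)) \<longlonglongrightarrow> prob (\<Union>n. ?A n)"
  proof (rule finite_Lim_measure_incseq)
    show "range ?A \<subseteq> events" by auto
    show "incseq ?A" by (rule incseq_SucI) (auto simp: atLeastAtMostSuc_conv)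
  qed
  then have "prob (\<Union>n. ?A n) \<le> ?R / \<epsilon>\<^sup>2"
    using A by (intro LIMSEQ_le_const2) auto
  moreover have "(\<Union>n. ?A n) = {w \<in> space M. \<exists>j\<ge>m. \<bar>window_sum m j (\<lambda>s. d s w)\<bar> \<ge> \<epsilon>}"
    by (auto intro: atLeastAtMost_iff[THEN iffD2])
  ultimately show ?thesis by simp
qed

lemma AE_window_small:
  assumes "\<epsilon> > 0"
  shows "AE w in M. \<exists>m. \<forall>j\<ge>m. \<bar>window_sum m j (\<lambda>s. d s w)\<bar> < \<epsilon>"
proof -
  let ?B = "{w \<in> space M. \<forall>m. \<exists>j\<ge>m. \<bar>window_sum m j (\<lambda>s. d s w)\<bar> \<ge> \<epsilon>}"
  let ?R = "\<lambda>m. ((\<Sum>t. (c t)\<^sup>2) - (\<Sum>t<m. (c t)\<^sup>2)) / \<epsilon>\<^sup>2"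
  have "prob ?B \<le> ?R m" for m
  proof -
    have "prob ?B \<le> prob {w \<in> space M. \<exists>j\<ge>m. \<bar>window_sum m j (\<lambda>s. d s w)\<bar> \<ge> \<epsilon>}"
      by (rule finite_measure_mono) auto
    then show ?thesis using maximal_inequality[OF assms, of m] by linarith
  qed
  moreover have "?R \<longlonglongrightarrow> ((\<Sum>t. (c t)\<^sup>2) - (\<Sum>t. (c t)\<^sup>2)) / \<epsilon>\<^sup>2"
    using assms by (intro tendsto_intros summable_LIMSEQ c) auto
  ultimately have "prob ?B \<le> 0"
    by (intro LIMSEQ_le_const[where X="?R"]) auto
  then have "prob ?B = 0" by (simp add: measure_le_0_iff)
  then show ?thesis
    by (intro AE_I[where N="?B"]) (auto simp: emeasure_eq_measure not_less)
qed

lemma AE_convergent_martingale_differences: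
  "AE w in M. convergent (\<lambda>n. \<Sum>t<n. d t w)"
proof -
  have "AE w in M. \<forall>r. \<exists>m. \<forall>j\<ge>m. \<bar>window_sum m j (\<lambda>s. d s w)\<bar> < inverse (real (Suc r))"
    unfolding AE_all_countable by (intro allI AE_window_small) simp
  then show ?thesis
  proof eventually_elim
    case (elim w)
    have "Cauchy (\<lambda>n. \<Sum>t<n. d t w)"
    proof (rule metric_CauchyI)
      fix e :: real assume "e > 0"
      then obtain r where r: "inverse (real (Suc r)) < e / 2" using reals_Archimedean[of "e / 2"] by auto
      obtain m where m: "\<And>j. j \<ge> m \<Longrightarrow> \<bar>window_sum m j (\<lambda>s. d s w)\<bar> < inverse (real (Suc r))"
        using elim by blast
      have near: "dist (\<Sum>t<j. d t w) (\<Sum>t<m. d t w) < e / 2" if "j \<ge> m" for j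
      proof -
        have "(\<Sum>t<j. d t w) = (\<Sum>t<m. d t w) + window_sum m j (\<lambda>s. d s w)"
          unfolding window_sum_def using that by (metis lessThan_atLeast0 sum.atLeastLessThan_concat zero_le)
        then show ?thesis using m[OF that] r by (simp add: dist_real_def)
      qed
      have "dist (\<Sum>t<i. d t w) (\<Sum>t<j. d t w) < e" if "i \<ge> m" "j \<ge> m" for i j
        using near[OF that(1)] near[OF that(2)] by (rule dist_triangle_half_l)
      then show "\<exists>M. \<forall>i\<ge>M. \<forall>j\<ge>M. dist (\<Sum>t<i. d t w) (\<Sum>t<j. d t w) < e" by blast
    qed
    then show ?case by (simp add: Cauchy_convergent_iff)
  qed
qed

end

end

section \<open>The one-step inequality\<close>

text \<open>The sequence of difference quotients gives joint measurability of the derivative, the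
  bound by \<open>C\<close> keeps the iterates in a ball, and the tangent inequality drives the
  descent.\<close>

lemma convex_lipschitz_deriv:
  fixes \<phi> :: "real \<Rightarrow> real"
  assumes "convex_on UNIV \<phi>" "\<phi> differentiable (at z)" "\<And>z z'. \<bar>\<phi> z - \<phi> z'\<bar> \<le> C * \<bar>z - z'\<bar>"
  shows "(\<lambda>n. (\<phi> (z + inverse (real (Suc n))) - \<phi> z) / inverse (real (Suc n))) \<longlonglongrightarrow> deriv \<phi> z"
    and "\<bar>deriv \<phi> z\<bar> \<le> C"
    and "deriv \<phi> z * (z' - z) \<le> \<phi> z' - \<phi> z"
proof -
  have D: "(\<phi> has_real_derivative deriv \<phi> z) (at z)"
    using assms(2) by (metis DERIV_imp_deriv real_differentiable_def)
  have "filterlim (\<lambda>n. inverse (real (Suc n))) (at 0) sequentially"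
    unfolding filterlim_at using LIMSEQ_inverse_real_of_nat by auto
  then show lim: "(\<lambda>n. (\<phi> (z + inverse (real (Suc n))) - \<phi> z) / inverse (real (Suc n))) \<longlonglongrightarrow> deriv \<phi> z"
    using D unfolding DERIV_def by (rule filterlim_compose[rotated])
  have "\<bar>(\<phi> (z + inverse (real (Suc n))) - \<phi> z) / inverse (real (Suc n))\<bar> \<le> C" for n
  proof -
    have "inverse (real (Suc n)) > 0" by simp
    then show ?thesis
      using assms(3)[of "z + inverse (real (Suc n))" z] by (simp only: abs_divide pos_divide_le_eq) simp
  qed
  then show "\<bar>deriv \<phi> z\<bar> \<le> C"
    by (intro LIMSEQ_le_const2[OF tendsto_rabs[OF lim]]) auto
  show "deriv \<phi> z * (z' - z) \<le> \<phi> z' - \<phi> z"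
    using convex_on_imp_above_tangent[OF assms(1), of z z' "deriv \<phi> z"] D by simp
qed

text \<open>Polarization splits \<open>lam * inner f (f - fs)\<close> into the regularizer
  difference and \<open>lam / 2 * (norm (f - fs))^2\<close>, and the latter times
  \<open>2 * \<eta>\<close> is the contraction. In the last constant, \<open>(2 * L)^2\<close>
  bounds the squared gradient, \<open>2 * (B + norm fs)\<close> the cross term with the KOMP error,
  and \<open>1 / lam^2\<close> the square of that error, by \<eta> < 1 / lam.\<close>

lemma polk_step_descent:
  fixes f fn fs \<kappa> :: "'h::real_inner"
  assumes g: "norm (fn - ((1 - \<eta> * lam) *\<^sub>R f - (\<eta> * a) *\<^sub>R \<kappa>)) \<le> \<eta>\<^sup>2"
    and \<eta>: "0 < \<eta>" "\<eta> < 1 / lam" and lam: "lam > 0"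
    and f: "norm f \<le> B" and B: "lam * B = L" and a\<kappa>: "norm (a *\<^sub>R \<kappa>) \<le> L"
    and tangent: "a * (inner fs \<kappa> - inner f \<kappa>) \<le> ls - lf"
  shows "(norm (fn - fs))\<^sup>2 \<le> (norm (f - fs))\<^sup>2 - lam * \<eta> * (norm (f - fs))\<^sup>2
      - 2 * \<eta> * ((lf - ls) + lam / 2 * ((norm f)\<^sup>2 - (norm fs)\<^sup>2))
      + ((2 * L)\<^sup>2 + 2 * (B + norm fs) + 1 / lam\<^sup>2) * \<eta>\<^sup>2"
proof -
  define g where "g = (1 - \<eta> * lam) *\<^sub>R f - (\<eta> * a) *\<^sub>R \<kappa>"
  define G where "G = lam *\<^sub>R f + a *\<^sub>R \<kappa>"
  have lf: "norm (lam *\<^sub>R f) \<le> L" using f lam B by (simp add: mult_left_mono flip: B)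
  have G: "norm G \<le> 2 * L"
    unfolding G_def using lf a\<kappa> norm_triangle_ineq[of "lam *\<^sub>R f" "a *\<^sub>R \<kappa>"] by linarith
  have gf: "g - fs = (f - fs) - \<eta> *\<^sub>R G" unfolding g_def G_def by (simp add: algebra_simps)
  have sq: "(norm (g - fs))\<^sup>2 = (norm (f - fs))\<^sup>2 - 2 * \<eta> * inner G (f - fs) + \<eta>\<^sup>2 * (norm G)\<^sup>2"
    unfolding gf power2_norm_eq_inner
    by (simp add: inner_diff_left inner_diff_right inner_commute power2_eq_square algebra_simps)
  have "inner G (f - fs) = lam / 2 * ((norm f)\<^sup>2 + (norm (f - fs))\<^sup>2 - (norm fs)\<^sup>2) + a * (inner f \<kappa> - inner fs \<kappa>)"
    unfolding G_def power2_norm_eq_inner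
    by (simp add: inner_add_left inner_diff_left inner_diff_right inner_commute algebra_simps)
  moreover have "a * (inner f \<kappa> - inner fs \<kappa>) \<ge> lf - ls"
    using tangent by (simp add: algebra_simps)
  ultimately have "inner G (f - fs) \<ge> lam / 2 * ((norm f)\<^sup>2 + (norm (f - fs))\<^sup>2 - (norm fs)\<^sup>2) + (lf - ls)"
    by linarith
  then have ineq: "2 * \<eta> * inner G (f - fs) \<ge> 2 * \<eta> * (lam / 2 * ((norm f)\<^sup>2 + (norm (f - fs))\<^sup>2 - (norm fs)\<^sup>2) + (lf - ls))"
    using \<eta> by (intro mult_left_mono) auto
  have G2: "\<eta>\<^sup>2 * (norm G)\<^sup>2 \<le> \<eta>\<^sup>2 * (2 * L)\<^sup>2"
    using G by (intro mult_left_mono power_mono) auto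
  \<comment> \<open>The step before KOMP stays in the same ball: with \<open>L = lam * B\<close> its
    bound is a convex combination of \<open>B\<close> and \<open>B\<close>.\<close>
  have "norm g \<le> B"
  proof -
    have "norm g \<le> norm ((1 - \<eta> * lam) *\<^sub>R f) + norm (\<eta> *\<^sub>R (a *\<^sub>R \<kappa>))"
      unfolding g_def using norm_triangle_ineq4[of "(1 - \<eta> * lam) *\<^sub>R f" "(\<eta> * a) *\<^sub>R \<kappa>"] by simp
    also have "norm ((1 - \<eta> * lam) *\<^sub>R f) \<le> (1 - \<eta> * lam) * B"
    proof -
      have "1 - \<eta> * lam \<ge> 0" using \<eta> lam by (simp add: field_simps)
      then show ?thesis using f by (simp add: mult_left_mono)
    qed
    also have "norm (\<eta> *\<^sub>R (a *\<^sub>R \<kappa>)) \<le> \<eta> * L" 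
      using a\<kappa> \<eta> by (simp only: norm_scaleR[of \<eta>]) (intro mult_mono, auto)
    also have "(1 - \<eta> * lam) * B + \<eta> * L = B" using B by (simp add: algebra_simps)
    finally show ?thesis by simp
  qed
  then have gfs: "norm (g - fs) \<le> B + norm fs" using norm_triangle_ineq4[of g fs] by linarith
  have "norm (fn - fs) \<le> norm (g - fs) + \<eta>\<^sup>2"
    using norm_triangle_ineq[of "g - fs" "fn - g"] g unfolding g_def[symmetric] by simp
  then have "(norm (fn - fs))\<^sup>2 \<le> (norm (g - fs) + \<eta>\<^sup>2)\<^sup>2" by (intro power_mono) auto
  also have "\<dots> = (norm (g - fs))\<^sup>2 + 2 * norm (g - fs) * \<eta>\<^sup>2 + \<eta>\<^sup>2 * \<eta>\<^sup>2"
    by (simp add: power2_eq_square algebra_simps)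
  also have "\<dots> \<le> (norm (g - fs))\<^sup>2 + 2 * (B + norm fs) * \<eta>\<^sup>2 + (1 / lam\<^sup>2) * \<eta>\<^sup>2"
  proof -
    have "\<eta>\<^sup>2 \<le> (1 / lam)\<^sup>2" using \<eta> by (intro power_mono) auto
    then have "\<eta>\<^sup>2 * \<eta>\<^sup>2 \<le> (1 / lam\<^sup>2) * \<eta>\<^sup>2"
      by (intro mult_right_mono) (auto simp: power_divide)
    moreover have "2 * norm (g - fs) * \<eta>\<^sup>2 \<le> 2 * (B + norm fs) * \<eta>\<^sup>2"
      using gfs by (intro mult_right_mono) auto
    ultimately show ?thesis by linarith
  qed
  finally show ?thesis using sq ineq G2 by (simp add: algebra_simps)
qed

section \<open>The sampled process for a separably valued feature map\<close>

locale polk_setting = prob_space M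
  for M :: "'w measure" +
  fixes Z :: "nat \<Rightarrow> 'w \<Rightarrow> 'x::euclidean_space \<times> real"
    and P :: "('x \<times> real) measure"
    and k :: "'x \<Rightarrow> 'h::real_inner" and l :: "real \<Rightarrow> real \<Rightarrow> real"
    and S :: "'h set" and e :: "nat \<Rightarrow> 'h"
    and lam Xb C :: real and eta eps :: "nat \<Rightarrow> real" and fstar :: 'h
  assumes indep: "indep_vars (\<lambda>_. borel) Z UNIV"
    and distr_Z: "\<And>t. distr M borel (Z t) = P"
    and S: "S = closure (span (range e))"
    and k_meas: "weakly_measurable_in S borel k"
    and k_bound: "\<And>x. norm (k x) \<le> Xb"
    and l_meas: "(\<lambda>(z, y). l z y) \<in> borel_measurable borel"
    and l_int: "\<And>g. integrable P (\<lambda>z. l (inner g (k (fst z))) (snd z))"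
    and lam_pos: "lam > 0"
    and fstar_min: "\<And>g. risk k l lam P fstar \<le> risk k l lam P g"
    and l_lip: "\<And>z z' y. \<bar>l z y - l z' y\<bar> \<le> C * \<bar>z - z'\<bar>"
    and l_convex: "\<And>y. convex_on UNIV (\<lambda>z. l z y)"
    and l_diff: "\<And>y z. (\<lambda>z. l z y) differentiable (at z)"
    and eta_pos: "\<And>t. eta t > 0"
    and eta_lt: "\<And>t. eta t < 1 / lam"
    and eta_div: "\<not> summable eta"
    and eta_sq: "summable (\<lambda>t. (eta t)\<^sup>2)"
    and eps_eq: "\<And>t. eps t = (eta t)\<^sup>2"
begin

abbreviation "hist_space t \<equiv> PiM {..<t} (\<lambda>_. borel :: ('x \<times> real) measure)"

text \<open>A deterministic function of a sample path, so that the past can be frozen while a fresh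
  sample is integrated out.\<close>

definition iter :: "nat \<Rightarrow> (nat \<Rightarrow> 'x \<times> real) \<Rightarrow> 'h" where
  "iter t h = fst (polk k l lam eta eps (\<lambda>s. fst (h s)) (\<lambda>s. snd (h s)) t)"

definition excess :: "nat \<Rightarrow> (nat \<Rightarrow> 'x \<times> real) \<Rightarrow> 'x \<times> real \<Rightarrow> real" where
  "excess t h z = l (inner (iter t h) (k (fst z))) (snd z) - l (inner fstar (k (fst z))) (snd z)"

definition mean_excess :: "nat \<Rightarrow> (nat \<Rightarrow> 'x \<times> real) \<Rightarrow> real" where
  "mean_excess t h = (\<integral>z. excess t h z \<partial>P)"

text \<open>What the one-step inequality leaves when the sampled loss excess is replaced by its
  mean; \<open>2 * eta t\<close> is the factor from expanding the square.\<close>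

definition noise :: "nat \<Rightarrow> (nat \<Rightarrow> 'x \<times> real) \<Rightarrow> real" where
  "noise t h = 2 * eta t * (mean_excess t h - excess t h (h t))"

text \<open>The fixed point of the norm recursion:
  \<open>(1 - eta t * lam) * radius + eta t * (C * Xb) = radius\<close>.\<close>

definition radius :: real where "radius = C * Xb / lam"

lemma Z_meas [measurable]: "Z t \<in> borel_measurable M"
  using indep unfolding indep_vars_def by auto

lemma sets_P [measurable_cong]: "sets P = sets borel"
  using distr_Z[of 0] by (metis sets_distr)

sublocale P: prob_space P
  using prob_space_distr[OF Z_meas, of 0] by (simp add: distr_Z)

lemma Xb_nonneg: "Xb \<ge> 0" using k_bound order_trans norm_ge_zero by blast

lemma C_nonneg: "C \<ge> 0" using l_lip[of 1 0 0] by simp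

lemmas l_deriv = convex_lipschitz_deriv[OF l_convex l_diff l_lip]

lemma deriv_l_meas: "(\<lambda>(z, y). deriv (\<lambda>z. l z y) z) \<in> borel_measurable (borel \<Otimes>\<^sub>M borel)"
proof -
  have [measurable]: "(\<lambda>p. l (fst p) (snd p)) \<in> borel_measurable (borel \<Otimes>\<^sub>M borel)"
    using l_meas by (simp add: case_prod_beta' borel_prod)
  have "(\<lambda>p. deriv (\<lambda>z. l z (snd p)) (fst p)) \<in> borel_measurable (borel \<Otimes>\<^sub>M borel)"
  proof (rule borel_measurable_LIMSEQ_real)
    show "(\<lambda>n. (l (fst p + inverse (real (Suc n))) (snd p) - l (fst p) (snd p)) / inverse (real (Suc n)))
        \<longlonglongrightarrow> deriv (\<lambda>z. l z (snd p)) (fst p)" for p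
      by (rule l_deriv(1))
    fix n
    have "(\<lambda>p. l (fst p + inverse (real (Suc n))) (snd p)) \<in> borel_measurable (borel \<Otimes>\<^sub>M borel)"
      using measurable_compose[OF _ \<open>(\<lambda>p. l (fst p) (snd p)) \<in> _\<close>,
          of "\<lambda>p. (fst p + inverse (real (Suc n)), snd p)" "borel \<Otimes>\<^sub>M borel"] by simp
    then show "(\<lambda>p. (l (fst p + inverse (real (Suc n))) (snd p) - l (fst p) (snd p)) / inverse (real (Suc n)))
        \<in> borel_measurable (borel \<Otimes>\<^sub>M borel)"
      by measurable
  qed
  then show ?thesis by (simp add: case_prod_beta')
qed

lemma iter_index: "iter t h = fst (polk (\<lambda>s. k (fst (h s))) l lam eta eps (\<lambda>s. s) (\<lambda>s. snd (h s)) t)"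
  unfolding iter_def by (subst polk_index) simp

lemma iter_cong: "(\<And>s. s < t \<Longrightarrow> h s = h' s) \<Longrightarrow> iter t h = iter t h'"
  unfolding iter_index by (intro arg_cong[where f=fst] polk_index_cong) auto

lemma iter_meas: "weakly_measurable_in S (hist_space t) (iter t)"
proof -
  \<comment> \<open>\<open>measurable_polk_index\<close> asks for measurable data at every index,
    while a history has coordinates below \<open>t\<close> only; the padding by 0 is invisible to
    \<open>iter t\<close>.\<close>
  define tr :: "nat \<Rightarrow> (nat \<Rightarrow> 'x \<times> real) \<Rightarrow> 'x \<times> real" where "tr s h = (if s < t then h s else 0)" for s h
  have tr: "tr s \<in> borel_measurable (hist_space t)" for s
    unfolding tr_def by (cases "s < t") (auto intro: measurable_component_singleton)
  have tr1: "(\<lambda>h. fst (tr s h)) \<in> borel_measurable (hist_space t)" "(\<lambda>h. snd (tr s h)) \<in> borel_measurable (hist_space t)" for s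
    by (auto intro!: borel_measurable_continuous_on[OF _ tr] continuous_intros)
  have "iter t h = fst (polk (\<lambda>s. k (fst (tr s h))) l lam eta eps (\<lambda>s. s) (\<lambda>s. snd (tr s h)) t)" for h
    unfolding iter_index[of t "\<lambda>s. tr s h", symmetric] by (rule iter_cong) (simp add: tr_def)
  then have "iter t = (\<lambda>h. fst (polk (\<lambda>s. k (fst (tr s h))) l lam eta eps (\<lambda>s. s) (\<lambda>s. snd (tr s h)) t))" by auto
  then show ?thesis
    using measurable_polk_index[OF S weakly_measurable_in_compose[OF k_meas tr1(1)] tr1(2) deriv_l_meas] by simp
qed

lemma iter_step:
  defines "a \<equiv> \<lambda>t h. deriv (\<lambda>z. l z (snd (h t))) (inner (iter t h) (k (fst (h t))))"
  shows "norm (iter t h) \<le> radius"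
    and "norm (iter (Suc t) h - ((1 - eta t * lam) *\<^sub>R iter t h - (eta t * a t h) *\<^sub>R k (fst (h t)))) \<le> (eta t)\<^sup>2"
    and "norm (a t h *\<^sub>R k (fst (h t))) \<le> C * Xb"
proof -
  show ak: "norm (a t h *\<^sub>R k (fst (h t))) \<le> C * Xb" for t
    unfolding norm_scaleR a_def using l_deriv(2) k_bound C_nonneg by (intro mult_mono) auto
  show "norm (iter t h) \<le> radius"
  proof (induction t)
    case 0
    then show ?case using C_nonneg Xb_nonneg lam_pos by (simp add: iter_def radius_def)
  next
    case (Suc t)
    obtain vs where vs: "iter (Suc t) h = gs_proj vs ((1 - eta t * lam) *\<^sub>R iter t h - (eta t * a t h) *\<^sub>R k (fst (h t)))"
      unfolding iter_def a_def by (rule polk_Suc_obtain)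
    have "norm (iter (Suc t) h) \<le> norm ((1 - eta t * lam) *\<^sub>R iter t h - eta t *\<^sub>R (a t h *\<^sub>R k (fst (h t))))"
      unfolding vs using norm_gs_proj_le by simp
    also have "\<dots> \<le> norm ((1 - eta t * lam) *\<^sub>R iter t h) + norm (eta t *\<^sub>R (a t h *\<^sub>R k (fst (h t))))"
      by (rule norm_triangle_ineq4)
    also have "norm ((1 - eta t * lam) *\<^sub>R iter t h) \<le> (1 - eta t * lam) * radius"
    proof -
      have "1 - eta t * lam \<ge> 0" using eta_lt[of t] lam_pos by (simp add: field_simps)
      then show ?thesis using Suc by (simp add: mult_left_mono)
    qed
    also have "norm (eta t *\<^sub>R (a t h *\<^sub>R k (fst (h t)))) \<le> eta t * (C * Xb)"
      using ak[of t] eta_pos[of t] by (simp only: norm_scaleR[of "eta t"]) (intro mult_mono, auto)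
    also have "(1 - eta t * lam) * radius + eta t * (C * Xb) = radius"
      using lam_pos by (simp add: radius_def field_simps)
    finally show ?case by simp
  qed
  show "norm (iter (Suc t) h - ((1 - eta t * lam) *\<^sub>R iter t h - (eta t * a t h) *\<^sub>R k (fst (h t)))) \<le> (eta t)\<^sup>2"
    using polk_step_error[of eps t] unfolding iter_def a_def eps_eq by simp
qed

lemma loss_diff_bound:
  "\<bar>l (inner g (k x)) y - l (inner g' (k x)) y\<bar> \<le> C * Xb * norm (g - g')"
proof -
  have "\<bar>l (inner g (k x)) y - l (inner g' (k x)) y\<bar> \<le> C * \<bar>inner (g - g') (k x)\<bar>"
    using l_lip[of "inner g (k x)" y "inner g' (k x)"] by (simp add: inner_diff_left)
  also have "\<dots> \<le> C * (norm (g - g') * Xb)"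
    using mult_left_mono[OF k_bound[of x] norm_ge_zero[of "g - g'"]] C_nonneg
    by (intro mult_left_mono[of _ _ C] order_trans[OF Cauchy_Schwarz_ineq2])
  finally show ?thesis by (simp add: algebra_simps)
qed

definition excess_bound :: real where "excess_bound = C * Xb * (radius + norm fstar)"

lemma excess_bounded: "\<bar>excess t h z\<bar> \<le> excess_bound"
proof -
  have "norm (iter t h - fstar) \<le> radius + norm fstar"
    using norm_triangle_ineq4[of "iter t h" fstar] iter_step(1)[of t h] by linarith
  then have "C * Xb * norm (iter t h - fstar) \<le> excess_bound"
    unfolding excess_bound_def using C_nonneg Xb_nonneg by (intro mult_left_mono) auto
  then show ?thesis unfolding excess_def using loss_diff_bound order_trans by blast
qed

text \<open>Both factors of the inner product vary here, the iterate with the past and the feature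
  with the fresh sample, so weak measurability of each is not enough without the common separable
  \<open>S\<close>.\<close>

lemma excess_meas [measurable]: "case_prod (excess t) \<in> borel_measurable (hist_space t \<Otimes>\<^sub>M borel)"
proof -
  have l': "(\<lambda>p. l (fst p) (snd p)) \<in> borel_measurable (borel \<Otimes>\<^sub>M borel)"
    using l_meas by (simp add: case_prod_beta' borel_prod)
  let ?N = "hist_space t \<Otimes>\<^sub>M (borel :: ('x \<times> real) measure)"
  have sn: "snd \<in> measurable ?N borel" by simp
  have z: "(\<lambda>p. fst (snd p)) \<in> borel_measurable ?N" "(\<lambda>p. snd (snd p)) \<in> borel_measurable ?N"
    by (auto intro!: borel_measurable_continuous_on[OF _ sn] continuous_intros)
  have it: "weakly_measurable_in S ?N (\<lambda>p. iter t (fst p))"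
    by (rule weakly_measurable_in_compose[OF iter_meas]) simp
  have kk: "weakly_measurable_in S ?N (\<lambda>p. k (fst (snd p)))"
    by (rule weakly_measurable_in_compose[OF k_meas z(1)])
  have 1: "(\<lambda>p. inner (iter t (fst p)) (k (fst (snd p)))) \<in> borel_measurable ?N"
    by (rule weakly_measurable_in_inner[OF S it kk])
  have 2: "(\<lambda>p. inner fstar (k (fst (snd p)))) \<in> borel_measurable ?N"
    using kk by (simp add: weakly_measurable_in_def inner_commute[of fstar])
  show ?thesis
    unfolding case_prod_beta' excess_def
    using measurable_compose[OF measurable_Pair[OF 1 z(2)] l'] measurable_compose[OF measurable_Pair[OF 2 z(2)] l']
    by (intro borel_measurable_diff) (simp_all add: case_prod_beta')
qed

lemma mean_excess_meas [measurable]: "mean_excess t \<in> borel_measurable (hist_space t)"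
proof -
  have "case_prod (excess t) \<in> borel_measurable (hist_space t \<Otimes>\<^sub>M P)"
    using excess_meas measurable_cong_sets[OF sets_pair_measure_cong[OF refl sets_P]] by blast
  from P.borel_measurable_lebesgue_integral[OF this] show ?thesis
    unfolding mean_excess_def by simp
qed

lemma mean_excess_eq:
  "mean_excess t h = (\<integral>z. l (inner (iter t h) (k (fst z))) (snd z) \<partial>P) - (\<integral>z. l (inner fstar (k (fst z))) (snd z) \<partial>P)"
  unfolding mean_excess_def excess_def by (rule Bochner_Integration.integral_diff[OF l_int l_int])

lemma excess_int: "integrable P (excess t h)"
  unfolding excess_def by (rule Bochner_Integration.integrable_diff[OF l_int l_int])

lemma mean_excess_bounded: "\<bar>mean_excess t h\<bar> \<le> excess_bound"
proof -
  have "\<bar>mean_excess t h\<bar> \<le> (\<integral>z. \<bar>excess t h z\<bar> \<partial>P)"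
    unfolding mean_excess_def by (rule integral_abs_bound)
  also have "\<dots> \<le> (\<integral>z. excess_bound \<partial>P)"
    using excess_int by (intro integral_mono) (auto simp: excess_bounded)
  also have "\<dots> = excess_bound" by (simp add: P.prob_space)
  finally show ?thesis .
qed

lemma noise_bounded: "\<bar>noise t h\<bar> \<le> 4 * excess_bound * eta t"
proof -
  have "\<bar>mean_excess t h - excess t h (h t)\<bar> \<le> 2 * excess_bound"
    using mean_excess_bounded[of t h] excess_bounded[of t h "h t"] by linarith
  then have "2 * eta t * \<bar>mean_excess t h - excess t h (h t)\<bar> \<le> 2 * eta t * (2 * excess_bound)"
    using eta_pos[of t] by (intro mult_left_mono) auto
  then show ?thesis using eta_pos[of t] by (simp add: noise_def abs_mult mult_ac)
qed

definition past :: "nat \<Rightarrow> 'w \<Rightarrow> nat \<Rightarrow> 'x \<times> real" where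
  "past t w = (\<lambda>s\<in>{..<t}. Z s w)"

lemma past_meas [measurable]: "past t \<in> measurable M (hist_space t)"
  unfolding past_def by (rule measurable_restrict) simp

lemma noise_cong: "(\<And>s. s \<le> t \<Longrightarrow> h s = h' s) \<Longrightarrow> noise t h = noise t h'"
  using iter_cong[of t h h'] by (simp add: noise_def mean_excess_def excess_def)

lemma noise_past: "s < t \<Longrightarrow> noise s (past t w) = noise s (\<lambda>s. Z s w)"
  by (rule noise_cong) (simp add: past_def)

lemma noise_hist_meas: 
  assumes "s < t"
  shows "noise s \<in> borel_measurable (hist_space t)"
proof -
  have r: "(\<lambda>h. restrict h {..<s}) \<in> measurable (hist_space t) (hist_space s)"
    using assms by (intro measurable_restrict_subset) auto
  have c: "(\<lambda>h. h s) \<in> measurable (hist_space t) borel"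
    using assms by (intro measurable_component_singleton) auto
  have it: "iter s (restrict h {..<s}) = iter s h" for h by (rule iter_cong) simp
  have "noise s h = 2 * eta s * (mean_excess s (restrict h {..<s}) - case_prod (excess s) (restrict h {..<s}, h s))" for h
    by (simp add: noise_def mean_excess_def excess_def it)
  then have "noise s = (\<lambda>h. 2 * eta s * (mean_excess s (restrict h {..<s}) - case_prod (excess s) (restrict h {..<s}, h s)))"
    by auto
  also have "\<dots> \<in> borel_measurable (hist_space t)"
    by (intro borel_measurable_times borel_measurable_const borel_measurable_diff
        measurable_compose[OF r mean_excess_meas] measurable_compose[OF measurable_Pair[OF r c] excess_meas])
  finally show ?thesis .
qed

text \<open>The past is independent of the sample at time \<open>t\<close>, so their joint law is a
  product. By Fubini's theorem the fresh sample is integrated first, and the excess minus its mean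
  vanishes.\<close>

lemma noise_orthogonal:
  assumes G[measurable]: "G \<in> borel_measurable (hist_space t)"
    and K: "\<And>w. w \<in> space M \<Longrightarrow> \<bar>G (past t w)\<bar> \<le> K"
  shows "expectation (\<lambda>w. G (past t w) * noise t (\<lambda>s. Z s w)) = 0"
proof -
  define F where "F = (\<lambda>(h, z). G h * (2 * eta t * (mean_excess t h - excess t h z)))"
  have F_meas[measurable]: "F \<in> borel_measurable (hist_space t \<Otimes>\<^sub>M borel)"
    unfolding F_def by measurable
  have FM: "F (past t w, Z t w) = G (past t w) * noise t (\<lambda>s. Z s w)" for w
    using iter_cong[of t "past t w" "\<lambda>s. Z s w"]
    by (simp add: F_def noise_def mean_excess_def excess_def past_def)
  define Q where "Q = distr M (hist_space t) (past t)"
  interpret Q: prob_space Q unfolding Q_def by (rule prob_space_distr) simp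
  interpret QP: pair_prob_space Q P ..
  \<comment> \<open>Independence is available for restrictions to disjoint index sets; the single
    sample is therefore treated as a family over \<open>{t}\<close> and projected back
    afterwards.\<close>
  let ?T = "PiM {t} (\<lambda>_. borel :: ('x \<times> real) measure)"
  define R where "R = distr M ?T (\<lambda>w. \<lambda>s\<in>{t}. Z s w)"
  have Z_sing[measurable]: "(\<lambda>w. \<lambda>s\<in>{t}. Z s w) \<in> measurable M ?T"
    by (rule measurable_restrict) simp
  have "indep_var (hist_space t) (past t) (PiM {t} (\<lambda>_. borel)) (\<lambda>w. \<lambda>s\<in>{t}. Z s w)"
    unfolding past_def using indep by (intro indep_var_restrict[where I=UNIV]) auto
  then have pair: "Q \<Otimes>\<^sub>M R = distr M (hist_space t \<Otimes>\<^sub>M ?T) (\<lambda>w. (past t w, \<lambda>s\<in>{t}. Z s w))"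
    unfolding indep_var_distribution_eq Q_def R_def by simp
  have proj[measurable]: "(\<lambda>u. u t) \<in> measurable ?T borel"
    by (rule measurable_component_singleton) simp
  have PR: "P = distr R borel (\<lambda>u. u t)"
    unfolding R_def by (subst distr_distr[OF proj Z_sing]) (simp add: comp_def distr_Z)
  have QQ: "Q = distr Q (hist_space t) (\<lambda>h. h)"
    unfolding Q_def by (simp add: distr_distr comp_def)
  have "Q \<Otimes>\<^sub>M P = distr Q (hist_space t) (\<lambda>h. h) \<Otimes>\<^sub>M distr R borel (\<lambda>u. u t)"
    using PR QQ by simp
  also have "\<dots> = distr (Q \<Otimes>\<^sub>M R) (hist_space t \<Otimes>\<^sub>M borel) (\<lambda>(h, u). (h, u t))"
  proof (rule pair_measure_distr)
    show "sigma_finite_measure (distr R borel (\<lambda>u. u t))"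
      using P.sigma_finite_measure_axioms PR by simp
  qed (simp_all add: Q_def R_def)
  also have "\<dots> = distr M (hist_space t \<Otimes>\<^sub>M borel) (\<lambda>w. (past t w, Z t w))"
    unfolding pair using Z_sing by (subst distr_distr) (auto simp: comp_def)
  finally have joint: "Q \<Otimes>\<^sub>M P = distr M (hist_space t \<Otimes>\<^sub>M borel) (\<lambda>w. (past t w, Z t w))" .
  have pm: "(\<lambda>w. (past t w, Z t w)) \<in> measurable M (hist_space t \<Otimes>\<^sub>M borel)" by measurable
  have "integrable M (\<lambda>w. F (past t w, Z t w))"
  proof (rule integrable_const_bound[where B="K * (4 * excess_bound * eta t)"])
    show "AE w in M. norm (F (past t w, Z t w)) \<le> K * (4 * excess_bound * eta t)"
    proof (rule AE_I2)
      fix w assume w: "w \<in> space M"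
      have "0 \<le> K" using K[OF w] by linarith
      then show "norm (F (past t w, Z t w)) \<le> K * (4 * excess_bound * eta t)"
        unfolding FM real_norm_def abs_mult using K[OF w] noise_bounded by (intro mult_mono) auto
    qed
  qed (rule measurable_compose[OF pm F_meas])
  then have int: "integrable (Q \<Otimes>\<^sub>M P) F"
    unfolding joint by (subst integrable_distr_eq[OF pm F_meas])
  have "expectation (\<lambda>w. F (past t w, Z t w)) = integral\<^sup>L (Q \<Otimes>\<^sub>M P) F"
    unfolding joint by (rule integral_distr[symmetric, OF pm F_meas])
  also have "\<dots> = (\<integral>h. (\<integral>z. F (h, z) \<partial>P) \<partial>Q)"
    using QP.integral_fst'[OF int] by simp
  also have "(\<lambda>h. \<integral>z. F (h, z) \<partial>P) = (\<lambda>h. 0)"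
  proof
    fix h
    have "(\<integral>z. F (h, z) \<partial>P) = G h * (2 * eta t * (\<integral>z. mean_excess t h - excess t h z \<partial>P))"
      unfolding F_def by simp
    also have "(\<integral>z. mean_excess t h - excess t h z \<partial>P) = 0"
      using excess_int[of t h] by (simp add: P.prob_space mean_excess_def)
    finally show "(\<integral>z. F (h, z) \<partial>P) = 0" by simp
  qed
  finally show ?thesis by (simp add: FM)
qed

lemma noise_sum_convergent: "AE w in M. convergent (\<lambda>n. \<Sum>t<n. noise t (\<lambda>s. Z s w))"
proof (rule AE_convergent_martingale_differences)
  have "noise t (\<lambda>s. Z s w) = noise t (past (Suc t) w)" for t w by (simp add: noise_past)
  then show "(\<lambda>w. noise t (\<lambda>s. Z s w)) \<in> borel_measurable M" for t
    using measurable_compose[OF past_meas noise_hist_meas, of t "Suc t"] by simp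
  show "\<bar>noise t (\<lambda>s. Z s w)\<bar> \<le> 4 * excess_bound * eta t" for t w by (rule noise_bounded)
  show "summable (\<lambda>t. (4 * excess_bound * eta t)\<^sup>2)"
    unfolding power_mult_distrib using eta_sq by (intro summable_mult)
  fix t K and g :: "(nat \<Rightarrow> real) \<Rightarrow> real"
  assume g: "g \<in> borel_measurable (PiM {..<t} (\<lambda>_. borel))"
    and K: "\<And>w. w \<in> space M \<Longrightarrow> \<bar>g (\<lambda>s\<in>{..<t}. noise s (\<lambda>s. Z s w))\<bar> \<le> K"
  \<comment> \<open>Earlier noise terms are functions of the samples before \<open>t\<close>, so a
    test function of the noise is one of the history.\<close>
  define G where "G h = g (\<lambda>s\<in>{..<t}. noise s h)" for h
  have "(\<lambda>h. \<lambda>s\<in>{..<t}. noise s h) \<in> measurable (hist_space t) (PiM {..<t} (\<lambda>_. borel))"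
    by (rule measurable_restrict) (simp add: noise_hist_meas)
  from measurable_compose[OF this g] have "G \<in> borel_measurable (hist_space t)"
    unfolding G_def .
  moreover have Gp: "G (past t w) = g (\<lambda>s\<in>{..<t}. noise s (\<lambda>s. Z s w))" for w
    unfolding G_def by (intro arg_cong[where f=g] restrict_ext) (simp add: noise_past)
  ultimately show "expectation (\<lambda>w. g (\<lambda>s\<in>{..<t}. noise s (\<lambda>s. Z s w)) * noise t (\<lambda>s. Z s w)) = 0"
    using noise_orthogonal[of G t K] K unfolding Gp by simp
qed

text \<open>\<open>mean_excess\<close> integrates over a fresh sample with \<open>h\<close> frozen,
  so minimality of \<open>fstar\<close> is tested at the fixed function
  \<open>iter t h\<close>.\<close>

lemma risk_excess_nonneg:
  "mean_excess t h + lam / 2 * ((norm (iter t h))\<^sup>2 - (norm fstar)\<^sup>2) \<ge> 0"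
  using fstar_min[of "iter t h"] unfolding mean_excess_eq risk_def eval_rkhs_def
  by (simp add: algebra_simps)

definition drift :: real where
  "drift = (2 * (C * Xb))\<^sup>2 + 2 * (radius + norm fstar) + 1 / lam\<^sup>2"

text \<open>Splitting the sampled excess into mean and noise leaves the mean together with the
  regularizer difference, a nonnegative excess risk, which is dropped.\<close>

lemma iter_descent:
  "(norm (iter (Suc t) h - fstar))\<^sup>2 \<le> (norm (iter t h - fstar))\<^sup>2
     - lam * eta t * (norm (iter t h - fstar))\<^sup>2 + (noise t h + drift * (eta t)\<^sup>2)"
proof -
  have B: "lam * radius = C * Xb" using lam_pos by (simp add: radius_def)
  note step = polk_step_descent[OF iter_step(2) eta_pos eta_lt lam_pos iter_step(1) B iter_step(3)
      l_deriv(3)[of "snd (h t)" "inner (iter t h) (k (fst (h t)))" "inner fstar (k (fst (h t)))"]]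
  have "2 * eta t * (mean_excess t h + lam / 2 * ((norm (iter t h))\<^sup>2 - (norm fstar)\<^sup>2)) \<ge> 0"
    using risk_excess_nonneg[of t h] eta_pos[of t] by (intro mult_nonneg_nonneg) auto
  then show ?thesis
    using step unfolding noise_def excess_def drift_def by (simp add: algebra_simps)
qed

theorem iter_converges:
  "AE w in M. (\<lambda>t. (norm (iter t (\<lambda>s. Z s w) - fstar))\<^sup>2) \<longlonglongrightarrow> 0"
  using noise_sum_convergent
proof eventually_elim
  case (elim w)
  have "convergent (\<lambda>n. \<Sum>t<n. drift * (eta t)\<^sup>2)"
    using summable_mult[OF eta_sq, of drift] unfolding summable_iff_convergent .
  from convergent_add[OF elim this]
  have conv: "convergent (\<lambda>n. \<Sum>t<n. noise t (\<lambda>s. Z s w) + drift * (eta t)\<^sup>2)"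
    by (simp add: sum.distrib)
  show ?case
    by (rule perturbed_descent_tendsto_0[OF _ _ eta_div conv lam_pos iter_descent])
      (auto simp: less_imp_le[OF eta_pos])
qed

text \<open>The expected loss is Lipschitz in the RKHS norm with constant \<open>C * Xb\<close>, and
  the regularizer is continuous.\<close>

lemma risk_converges:
  assumes "(\<lambda>t. (norm (g t - fstar))\<^sup>2) \<longlonglongrightarrow> 0"
  shows "(\<lambda>t. risk k l lam P (g t) - risk k l lam P fstar) \<longlonglongrightarrow> 0"
proof -
  have n0: "(\<lambda>t. norm (g t - fstar)) \<longlonglongrightarrow> 0"
    using tendsto_real_sqrt[OF assms] by simp
  then have g: "g \<longlonglongrightarrow> fstar" using LIM_zero_cancel tendsto_norm_zero_iff by blast
  let ?I = "\<lambda>g. \<integral>z. l (inner g (k (fst z))) (snd z) \<partial>P"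
  have "\<bar>?I g - ?I g'\<bar> \<le> C * Xb * norm (g - g')" for g g'
  proof -
    have "\<bar>?I g - ?I g'\<bar> = \<bar>\<integral>z. l (inner g (k (fst z))) (snd z) - l (inner g' (k (fst z))) (snd z) \<partial>P\<bar>"
      by (simp add: Bochner_Integration.integral_diff[OF l_int l_int])
    also have "\<dots> \<le> (\<integral>z. \<bar>l (inner g (k (fst z))) (snd z) - l (inner g' (k (fst z))) (snd z)\<bar> \<partial>P)"
      by (rule integral_abs_bound)
    also have "\<dots> \<le> (\<integral>z. C * Xb * norm (g - g') \<partial>P)"
      using Bochner_Integration.integrable_diff[OF l_int l_int]
      by (intro integral_mono) (auto simp: loss_diff_bound)
    finally show ?thesis by (simp add: P.prob_space)
  qed
  then have "(\<lambda>t. ?I (g t) - ?I fstar) \<longlonglongrightarrow> 0"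
    by (intro Lim_null_comparison[OF _ tendsto_mult_right_zero[OF n0, of "C * Xb"]] always_eventually)
      (auto simp: real_norm_def)
  moreover have "(\<lambda>t. lam / 2 * (norm (g t))\<^sup>2 - lam / 2 * (norm fstar)\<^sup>2) \<longlonglongrightarrow>
      lam / 2 * (norm fstar)\<^sup>2 - lam / 2 * (norm fstar)\<^sup>2"
    by (intro tendsto_intros g)
  ultimately have "(\<lambda>t. (?I (g t) - ?I fstar) + (lam / 2 * (norm (g t))\<^sup>2 - lam / 2 * (norm fstar)\<^sup>2)) \<longlonglongrightarrow> 0"
    using tendsto_add by fastforce
  then show ?thesis unfolding risk_def eval_rkhs_def by (simp add: algebra_simps)
qed

end

section \<open>Reduction to a separably valued feature map\<close>

theorem theorem1:
  fixes M :: "'w measure"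
    and P :: "('x::euclidean_space \<times> real) measure"
    and xs :: "nat \<Rightarrow> 'w \<Rightarrow> 'x" and ys :: "nat \<Rightarrow> 'w \<Rightarrow> real"
    and k :: "'x \<Rightarrow> 'h::{real_inner, complete_space}"
    and l :: "real \<Rightarrow> real \<Rightarrow> real"
    and Xs :: "'x set" and Ys :: "real set"
    and lam Xb C sigma :: real
    and eta eps :: "nat \<Rightarrow> real"
    and fstar :: "'h"
  defines "f \<equiv> (\<lambda>t w. fst (polk k l lam eta eps (\<lambda>s. xs s w) (\<lambda>s. ys s w) t))"
  assumes M: "prob_space M"
    and P_sets: "sets P = sets borel"
    and xy_meas: "\<And>t. (\<lambda>w. (xs t w, ys t w)) \<in> measurable M borel"
    and iid_indep: "prob_space.indep_vars M (\<lambda>_. borel) (\<lambda>t w. (xs t w, ys t w)) UNIV"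
    and iid_distr: "\<And>t. distr M borel (\<lambda>w. (xs t w, ys t w)) = P"
    and support: "AE z in P. z \<in> Xs \<times> Ys"
    and rkhs: "closure (span (k ` Xs)) = UNIV"
    and k_meas: "k \<in> borel_measurable borel"
    and l_meas: "(\<lambda>(z, y). l z y) \<in> borel_measurable borel"
    and risk_def: "\<And>g. integrable P (\<lambda>z. l (eval_rkhs k g (fst z)) (snd z))"
    and lam_pos: "lam > 0"
    and fstar_min: "\<And>g. risk k l lam P fstar \<le> risk k l lam P g"
    and A1: "compact Xs" "compact Ys" "\<And>x. x \<in> Xs \<Longrightarrow> sqrt (kern k x x) \<le> Xb"
    and A2: "\<And>z z' y. y \<in> Ys \<Longrightarrow> \<bar>l z y - l z' y\<bar> \<le> C * \<bar>z - z'\<bar>"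
    and A3: "\<And>y. y \<in> Ys \<Longrightarrow> convex_on UNIV (\<lambda>z. l z y)"
            "\<And>y z. y \<in> Ys \<Longrightarrow> (\<lambda>z. l z y) differentiable (at z)"
    and A4: "\<And>t. AE w in M.
               nn_cond_exp M (hist M xs ys t)
                 (\<lambda>w. ennreal ((norm ((f t w - f (Suc t) w) /\<^sub>R eta t))^2)) w
               \<le> ennreal (sigma^2)"
    and eta_pos: "\<And>t. eta t > 0"
    and eta_lt: "\<And>t. eta t < 1 / lam"
    and eta_div: "\<not> summable eta"
    and eta_sq: "summable (\<lambda>t. (eta t)^2)"
    and eps_def: "\<And>t. eps t = (eta t)^2"
  shows "(AE w in M. liminf (\<lambda>t. ereal (risk k l lam P (f t w) - risk k l lam P fstar)) = 0)
       \<and> (AE w in M. (\<lambda>t. (norm (f t w - fstar))^2) \<longlonglongrightarrow> 0)"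
proof -
  interpret prob_space M by (rule M)
  define Z where "Z t w = (xs t w, ys t w)" for t w
  have Z_meas: "Z t \<in> borel_measurable M" and Z_distr: "distr M borel (Z t) = P" for t
    unfolding Z_def using xy_meas iid_distr by auto
  interpret P: prob_space P
    using prob_space_distr[OF Z_meas, of 0] by (simp add: Z_distr)
  have P_meas: "measurable P N = measurable borel N" for N :: "'n measure"
    by (rule measurable_cong_sets[OF P_sets refl])
  have fst_meas: "fst \<in> measurable P borel" and snd_meas: "snd \<in> measurable P borel"
    unfolding P_meas by (auto intro!: borel_measurable_continuous_onI continuous_intros)
  obtain e :: "nat \<Rightarrow> 'h" where e: "AE x in distr P borel fst. k x \<in> closure (range e)"
    by (rule borel_map_AE_separable[OF P.finite_measure_distr[OF fst_meas] sets_distr k_meas])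
  define S where "S = closure (span (range e))"
  have "AE z in P. k (fst z) \<in> closure (range e)" using AE_distrD[OF fst_meas e] .
  then have kS: "AE z in P. k (fst z) \<in> S"
    unfolding S_def by eventually_elim (meson closure_mono span_superset subsetD)
  \<comment> \<open>Borel since \<open>Xs\<close> is compact and \<open>S\<close> is closed. On
    \<open>A\<close> the norm bound, assumed on \<open>Xs\<close> only, and membership in
    \<open>S\<close> hold together.\<close>
  define A where "A = Xs \<inter> k -` S"
  have A: "A \<in> sets borel"
  proof -
    have "k -` S \<inter> space borel \<in> sets borel"
      by (rule measurable_sets[OF k_meas]) (simp add: S_def)
    then show ?thesis using A1(1) by (auto simp: A_def compact_imp_closed)
  qed
  have Ys: "Ys \<in> sets borel" using A1(2) by (simp add: compact_imp_closed)
  \<comment> \<open>The loss off Ys is arbitrary, so its derivative may fail to be measurable there; changing k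
    and l off the support affects neither the risk nor, almost surely, the iterates.\<close>
  define k' where "k' x = (if x \<in> A then k x else 0)" for x
  define l' where "l' z y = (if y \<in> Ys then l z y else 0)" for z y
  have good: "AE z in P. fst z \<in> A \<and> snd z \<in> Ys"
    using support kS by eventually_elim (auto simp: A_def)
  have k_inner: "(\<lambda>x. inner (k x) h) \<in> borel_measurable borel" for h
    by (rule borel_measurable_continuous_on[OF _ k_meas]) (intro continuous_intros)
  have k'_meas: "weakly_measurable_in S borel k'"
    unfolding weakly_measurable_in_def
  proof (intro conjI ballI allI)
    show "k' x \<in> S" for x
      using subspace_0[OF subspace_closure_span, of "range e"] by (simp add: k'_def A_def S_def)
    have "(\<lambda>x. inner (k' x) h) = (\<lambda>x. if x \<in> A then inner (k x) h else 0)" for h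
      by (auto simp: k'_def)
    then show "(\<lambda>x. inner (k' x) h) \<in> borel_measurable borel" for h
      using A k_inner by (auto intro: measurable_If_set)
  qed
  have l'_meas: "(\<lambda>(z, y). l' z y) \<in> borel_measurable borel"
  proof -
    have "(\<lambda>p. if p \<in> snd -` Ys then (\<lambda>(z, y). l z y) p else 0) \<in> borel_measurable (borel :: (real \<times> real) measure)"
    proof (rule measurable_If_set[OF l_meas])
      have "(snd :: real \<times> real \<Rightarrow> real) \<in> borel_measurable borel"
        by (intro borel_measurable_continuous_onI continuous_intros)
      from measurable_sets[OF this Ys]
      show "(snd -` Ys) \<inter> space borel \<in> sets (borel :: (real \<times> real) measure)" by simp
    qed simp
    moreover have "(\<lambda>(z, y). l' z y) = (\<lambda>p. if p \<in> snd -` Ys then (\<lambda>(z, y). l z y) p else 0)"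
      by (auto simp: l'_def)
    ultimately show ?thesis by simp
  qed
  have loss_meas: "(\<lambda>z. l' (inner g (k' (fst z))) (snd z)) \<in> borel_measurable P" for g
  proof -
    have "(\<lambda>x. inner g (k' x)) \<in> borel_measurable borel"
      using k'_meas by (simp add: weakly_measurable_in_def inner_commute[of g])
    from measurable_compose[OF fst_meas this]
    have "(\<lambda>z. (inner g (k' (fst z)), snd z)) \<in> measurable P borel"
      using snd_meas by (intro borel_measurable_Pair) auto
    from measurable_compose[OF this l'_meas] show ?thesis by simp
  qed
  have loss_eq: "AE z in P. l (eval_rkhs k g (fst z)) (snd z) = l' (inner g (k' (fst z))) (snd z)" for g
    using good by eventually_elim (simp add: l'_def k'_def eval_rkhs_def)
  have loss_int: "integrable P (\<lambda>z. l' (inner g (k' (fst z))) (snd z))" for g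
    using integrable_cong_AE_imp[OF risk_def loss_meas] loss_eq by (auto simp: eq_commute)
  have risk_eq: "risk k' l' lam P g = risk k l lam P g" for g
  proof -
    have "(\<integral>z. l (eval_rkhs k g (fst z)) (snd z) \<partial>P) = (\<integral>z. l' (inner g (k' (fst z))) (snd z) \<partial>P)"
      by (rule integral_cong_AE[OF borel_measurable_integrable[OF risk_def] loss_meas loss_eq])
    then show ?thesis by (simp add: Defs.risk_def eval_rkhs_def)
  qed
  \<comment> \<open>The bounds must also hold where \<open>k'\<close> or \<open>l'\<close> is 0;
    taking the maximum with 0 secures this whatever the signs of \<open>Xb\<close> and
    \<open>C\<close>.\<close>
  interpret polk_setting M Z P k' l' S e lam "max Xb 0" "max C 0" eta eps fstar
  proof
    show "indep_vars (\<lambda>_. borel) Z UNIV" using iid_indep unfolding Z_def .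
    show "norm (k' x) \<le> max Xb 0" for x
      using A1(3)[of x] by (auto simp: k'_def A_def kern_def norm_eq_sqrt_inner)
    show "\<bar>l' z y - l' z' y\<bar> \<le> max C 0 * \<bar>z - z'\<bar>" for z z' y
    proof (cases "y \<in> Ys")
      case True
      have "C * \<bar>z - z'\<bar> \<le> max C 0 * \<bar>z - z'\<bar>" by (intro mult_right_mono) auto
      then show ?thesis using A2[OF True, of z z'] True by (simp add: l'_def)
    qed (simp add: l'_def)
    show "convex_on UNIV (\<lambda>z. l' z y)" for y
      using A3(1)[of y] by (cases "y \<in> Ys") (auto simp: l'_def convex_on_const)
    show "(\<lambda>z. l' z y) differentiable (at z)" for y z
      using A3(2)[of y z] by (cases "y \<in> Ys") (auto simp: l'_def)
  qed (use Z_distr k'_meas l'_meas loss_int fstar_min lam_pos eta_pos eta_lt eta_div eta_sq eps_def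
      in \<open>simp_all add: S_def risk_eq\<close>)
  \<comment> \<open>Countably many samples share one null set, so the original and the modified
    iterates agree at all times simultaneously.\<close>
  have "AE w in M. \<forall>s. fst (Z s w) \<in> A \<and> snd (Z s w) \<in> Ys"
    unfolding AE_all_countable
    using good AE_distrD[OF Z_meas] unfolding Z_distr by blast
  then have f_eq: "AE w in M. \<forall>t. f t w = iter t (\<lambda>s. Z s w)"
  proof eventually_elim
    case (elim w)
    show ?case
    proof
      fix t
      have "polk (\<lambda>s. k (xs s w)) l lam eta eps (\<lambda>s. s) (\<lambda>s. ys s w) t =
          polk (\<lambda>s. k' (fst (Z s w))) l' lam eta eps (\<lambda>s. s) (\<lambda>s. snd (Z s w)) t"
        using elim by (intro polk_index_cong) (auto simp: k'_def l'_def Z_def)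
      then show "f t w = iter t (\<lambda>s. Z s w)"
        unfolding f_def iter_index by (subst polk_index) simp
    qed
  qed
  have conv: "AE w in M. (\<lambda>t. (norm (f t w - fstar))^2) \<longlonglongrightarrow> 0"
    using f_eq iter_converges by eventually_elim simp
  moreover from conv have "AE w in M. liminf (\<lambda>t. ereal (risk k l lam P (f t w) - risk k l lam P fstar)) = 0"
  proof eventually_elim
    case (elim w)
    from risk_converges[OF elim]
    have "(\<lambda>t. ereal (risk k l lam P (f t w) - risk k l lam P fstar)) \<longlonglongrightarrow> ereal 0"
      unfolding risk_eq by (intro tendsto_ereal)
    then show ?case using lim_imp_Liminf by (metis trivial_limit_sequentially zero_ereal_def)
  qed
  ultimately show ?thesis by blast
qed

end
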